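(* $\mathring{\mathcal{P}}_n$ is a two-sided ideal of the peak algebra $\mathcal{P}_n$. Moreover, for $n\geq 2$, $\mathcal{P}_n/\mathring{\mathcal{P}}_n\cong\mathcal{P}_{n-2}$.
   Context: $\mathfrak{S}_n$ is the symmetric group, $u=u_1\dots u_n$, with group algebra $\mathbb{Q}\mathfrak{S}_n$ (product = composition). $\mathrm{Peak}(u)=\{i\in[n-1]: u_{i-1}<u_i>u_{i+1}\}$ with $u_0=0$; the interior peak set is $\mathring{\mathrm{Peak}}(u)=\{i\in\{2,\dots,n-1\}: u_{i-1}<u_i>u_{i+1}\}$. $\mathcal{F}_n$ is the set of subsets of $[n-1]$ with no two consecutive integers, and $\mathring{\mathcal{F}}_n=\{F\in\mathcal{F}_n: 1\notin F\}$. $P_F=\sum_{\mathrm{Peak}(u)=F}u$ ($F\in\mathcal{F}_n$), $\mathring{P}_F=\sum_{\mathring{\mathrm{Peak}}(u)=F}u$ ($F\in\mathring{\mathcal{F}}_n$). The peak algebra is $\mathcal{P}_n=\mathrm{span}\{P_F\}$ (a subalgebra of $\mathbb{Q}\mathfrak{S}_n$), the peak ideal is $\mathring{\mathcal{P}}_n=\mathrm{span}\{\mathring{P}_F\}$. By convention $\mathcal{P}_0=\mathcal{P}_1=\mathbb{Q}$. *)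

theory Defs
  imports Complex_Main
begin

definition perms :: "nat \<Rightarrow> nat list set" where
  "perms n = {u. distinct u \<and> set u = {1..n}}"

(* Elements of the group algebra Q S_n: rational-valued functions on lists,
   supported on perms n (coefficient of u is x u). *)
definition ga :: "nat \<Rightarrow> (nat list \<Rightarrow> rat) set" where
  "ga n = {x. \<forall>u. u \<notin> perms n \<longrightarrow> x u = 0}"

definition pcomp :: "nat list \<Rightarrow> nat list \<Rightarrow> nat list" where
  "pcomp u v = map (\<lambda>i. u ! (i - 1)) v"

definition ga_mult :: "nat \<Rightarrow> (nat list \<Rightarrow> rat) \<Rightarrow> (nat list \<Rightarrow> rat) \<Rightarrow> (nat list \<Rightarrow> rat)" where
  "ga_mult n x y = (\<lambda>w. if w \<in> perms n then
      (\<Sum>p \<in> {(u,v). u \<in> perms n \<and> v \<in> perms n \<and> pcomp u v = w}. x (fst p) * y (snd p))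
     else 0)"

definition val :: "nat list \<Rightarrow> nat \<Rightarrow> nat" where
  "val u i = (if i = 0 then 0 else u ! (i - 1))"

definition Peak :: "nat \<Rightarrow> nat list \<Rightarrow> nat set" where
  "Peak n u = {i \<in> {1..n-1}. val u (i-1) < val u i \<and> val u i > val u (i+1)}"

definition IPeak :: "nat \<Rightarrow> nat list \<Rightarrow> nat set" where
  "IPeak n u = {i \<in> {2..n-1}. val u (i-1) < val u i \<and> val u i > val u (i+1)}"

definition Fam :: "nat \<Rightarrow> nat set set" where
  "Fam n = {F. F \<subseteq> {1..n-1} \<and> (\<forall>i\<in>F. i + 1 \<notin> F)}"

definition IFam :: "nat \<Rightarrow> nat set set" where
  "IFam n = {F \<in> Fam n. 1 \<notin> F}"

definition PF :: "nat \<Rightarrow> nat set \<Rightarrow> (nat list \<Rightarrow> rat)" where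
  "PF n F = (\<lambda>w. if w \<in> perms n \<and> Peak n w = F then 1 else 0)"

definition IPF :: "nat \<Rightarrow> nat set \<Rightarrow> (nat list \<Rightarrow> rat)" where
  "IPF n F = (\<lambda>w. if w \<in> perms n \<and> IPeak n w = F then 1 else 0)"

definition peak_alg :: "nat \<Rightarrow> (nat list \<Rightarrow> rat) set" where
  "peak_alg n = {x. \<exists>c :: nat set \<Rightarrow> rat. x = (\<lambda>w. \<Sum>F\<in>Fam n. c F * PF n F w)}"

definition peak_ideal :: "nat \<Rightarrow> (nat list \<Rightarrow> rat) set" where
  "peak_ideal n = {x. \<exists>c :: nat set \<Rightarrow> rat. x = (\<lambda>w. \<Sum>F\<in>IFam n. c F * IPF n F w)}"

end

theory Submission
  imports Defs "HOL-Combinatorics.Permutations"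
begin

text \<open>Letters are natural numbers: \<open>0\<close> is neutral, \<open>2 j\<close> stands for \<open>+j\<close> and \<open>2 j - 1\<close> for \<open>-j\<close>, so
  that Stembridge's order \<open>0 < -1 < 1 < -2 < 2 < \<dots>\<close> is the usual one and the sign is the parity.
  For a word \<open>p\<close> of absolute values let \<open>fp p w\<close> count the enriched words over \<open>w\<close> with absolute
  values \<open>p\<close>. It depends only on the peak set of \<open>w\<close>, and only on the interior peak set if \<open>0\<close> does not
  occur in \<open>p\<close>; by triangularity these functions span the peak algebra, respectively the peak ideal.
  The group algebra product of \<open>fp p\<close> and \<open>fp q\<close> is a sum of functions \<open>fp c\<close>, because pairs of
  letters, ordered lexicographically with the inner order reversed under negative outer letters,
  again form such an alphabet. As the pair \<open>(0, 0)\<close> is its neutral letter, words without \<open>0\<close> span a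
  two-sided ideal, and removing two leading zeros from \<open>p\<close> and \<open>q\<close> amounts to removing two leading
  zeros from \<open>c\<close>. On the group algebra this removal is \<open>x \<mapsto> (w \<mapsto> x (12w'') - x (21w''))\<close>, where \<open>w''\<close> is
  \<open>w\<close> with all letters raised by \<open>2\<close>.\<close>

section \<open>Enriched words over a permutation\<close>

definition blk :: "nat \<Rightarrow> nat" where
  "blk l = (l + 1) div 2"

text \<open>These are enriched P-partitions of the labelled chain \<open>w\<close>, in the left
  version where the value \<open>0\<close> is allowed. Through \<open>val\<close>, both words are
  read with a letter \<open>0\<close> in front, the same convention as in
  \<open>Peak\<close>.\<close>

definition ecompat :: "nat list \<Rightarrow> nat list \<Rightarrow> bool" where
  "ecompat f w \<longleftrightarrow> length f = length w \<and>
     (\<forall>i<length w. val f i < val f (Suc i) \<or>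
        val f i = val f (Suc i) \<and>
        (if even (val f i) then val w i < val w (Suc i) else val w (Suc i) < val w i))"

definition enriched :: "nat list \<Rightarrow> nat list \<Rightarrow> nat list set" where
  "enriched p w = {f. ecompat f w \<and> map blk f = p}"

lemma val_0 [simp]: "val u 0 = 0"
  by (simp add: val_def)

lemma val_Suc [simp]: "val u (Suc i) = u ! i"
  by (simp add: val_def)

lemma val_snoc: "i \<le> length u \<Longrightarrow> val (u @ v) i = val u i"
  by (cases i) (auto simp: nth_append)

lemma ecompat_snoc:
  "ecompat (f @ [l]) (w @ [a]) \<longleftrightarrow> ecompat f w \<and>
     (val f (length w) < l \<or> val f (length w) = l \<and>
       (if even l then val w (length w) < a else a < val w (length w)))"
proof (cases "length f = length w")
  case True
  have "(\<forall>i<length w. val (f @ [l]) i < val (f @ [l]) (Suc i) \<or>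
        val (f @ [l]) i = val (f @ [l]) (Suc i) \<and>
        (if even (val (f @ [l]) i) then val (w @ [a]) i < val (w @ [a]) (Suc i)
         else val (w @ [a]) (Suc i) < val (w @ [a]) i)) \<longleftrightarrow>
      (\<forall>i<length w. val f i < val f (Suc i) \<or> val f i = val f (Suc i) \<and>
        (if even (val f i) then val w i < val w (Suc i) else val w (Suc i) < val w i))"
    using True by (intro all_cong) (simp add: val_snoc nth_append)
  then show ?thesis
    using True by (auto simp: ecompat_def All_less_Suc val_snoc nth_append)
qed (auto simp: ecompat_def)

lemma blk_0 [simp]: "blk 0 = 0"
  by (simp add: blk_def)

lemma blk_eq_0_iff [simp]: "blk l = 0 \<longleftrightarrow> l = 0"
  by (auto simp: blk_def)

lemma blk_mono: "l \<le> m \<Longrightarrow> blk l \<le> blk m"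
  by (simp add: blk_def div_le_mono)

lemma val_map_blk: "i \<le> length f \<Longrightarrow> val (map blk f) i = blk (val f i)"
  by (cases i) (auto simp: blk_def)

lemma finite_blk_vimage: "finite {f. map blk f = p}"
proof -
  have "{f. map blk f = p} \<subseteq> {f. set f \<subseteq> {..2 * sum_list p} \<and> length f = length p}"
  proof clarify
    fix f assume p: "p = map blk f"
    have "l \<le> 2 * sum_list (map blk f)" if "l \<in> set f" for l
    proof -
      have "l \<le> 2 * blk l" by (auto simp: blk_def)
      also have "blk l \<le> sum_list (map blk f)"
        using that by (intro member_le_sum_list) auto
      finally show ?thesis by simp
    qed
    then show "set f \<subseteq> {..2 * sum_list (map blk f)} \<and> length f = length (map blk f)"
      by auto
  qed
  then show ?thesis
    using finite_lists_length_eq finite_subset by blast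
qed

lemma finite_enriched [simp]: "finite (enriched p w)"
  by (rule finite_subset[OF _ finite_blk_vimage[of p]]) (auto simp: enriched_def)

section \<open>Counting enriched words with prescribed absolute values\<close>

definition admissible :: "nat list \<Rightarrow> nat list \<Rightarrow> bool" where
  "admissible p w \<longleftrightarrow> length p = length w \<and> (\<forall>i<length w. val p i \<le> val p (Suc i)) \<and>
     (\<forall>i. Suc i < length w \<longrightarrow> val w i < val w (Suc i) \<longrightarrow> val w (Suc (Suc i)) < val w (Suc i) \<longrightarrow>
        \<not> (val p i = val p (Suc i) \<and> val p (Suc i) = val p (Suc (Suc i))))"

text \<open>This describes when the last letter cannot be odd: it would continue its block over an
  ascent. The empty word is included because the letter \<open>0\<close> put in front is
  even.\<close>

definition rising_end :: "nat list \<Rightarrow> nat list \<Rightarrow> bool" where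
  "rising_end p w \<longleftrightarrow> (length w = 0 \<or>
     val p (length w - 1) = val p (length w) \<and> val w (length w - 1) < val w (length w))"

lemma admissible_snoc:
  assumes "length p = length w"
  shows "admissible (p @ [j]) (w @ [a]) \<longleftrightarrow> admissible p w \<and> val p (length w) \<le> j \<and>
     \<not> (w \<noteq> [] \<and> rising_end p w \<and> a < val w (length w) \<and> val p (length w) = j)"
proof (cases w rule: rev_cases)
  case Nil
  with assms show ?thesis by (simp add: admissible_def)
next
  case (snoc w' b)
  with assms obtain p' k where p: "p = p' @ [k]" "length p' = length w'"
    by (cases p rule: rev_cases) auto
  have 1: "(\<forall>i<length w. val (p @ [j]) i \<le> val (p @ [j]) (Suc i)) \<longleftrightarrow>
        (\<forall>i<length w. val p i \<le> val p (Suc i))"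
    using assms by (intro all_cong) (simp add: val_snoc nth_append)
  define P where "P = (\<lambda>p w i. val w i < val w (Suc i) \<longrightarrow> val w (Suc (Suc i)) < val w (Suc i) \<longrightarrow>
        \<not> (val p i = val p (Suc i) \<and> val p (Suc i) = val p (Suc (Suc (i::nat)))))"
  have 2: "(\<forall>i. Suc i < length w \<longrightarrow> P (p @ [j]) (w @ [a]) i) \<longleftrightarrow> (\<forall>i. Suc i < length w \<longrightarrow> P p w i)"
    unfolding P_def using assms by (intro all_cong) (simp add: val_snoc nth_append)
  have 3: "(\<forall>i. Suc i < Suc (length w) \<longrightarrow> Q i) \<longleftrightarrow> (\<forall>i. Suc i < length w \<longrightarrow> Q i) \<and> Q (length w')" for Q
    using snoc by (auto simp: less_Suc_eq)
  have 4: "P (p @ [j]) (w @ [a]) (length w') \<longleftrightarrow>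
     \<not> (w \<noteq> [] \<and> rising_end p w \<and> a < val w (length w) \<and> val p (length w) = j)"
    using snoc p by (auto simp: P_def rising_end_def val_snoc nth_append)
  have "admissible (p @ [j]) (w @ [a]) \<longleftrightarrow> 
      (\<forall>i<length w. val (p @ [j]) i \<le> val (p @ [j]) (Suc i)) \<and> val p (length w) \<le> j \<and>
      (\<forall>i. Suc i < Suc (length w) \<longrightarrow> P (p @ [j]) (w @ [a]) i)"
    using assms by (auto simp: admissible_def P_def All_less_Suc val_snoc nth_append)
  then show ?thesis
    unfolding 1 3 2 4 using assms by (auto simp: admissible_def P_def)
qed

lemma admissible_le:
  assumes "admissible p w" "x \<in> set p"
  shows "x \<le> val p (length w)"
proof -
  from assms obtain i where i: "i < length w" "x = p ! i"
    by (auto simp: in_set_conv_nth admissible_def)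
  have "val p (Suc i) \<le> val p k" if "Suc i \<le> k" "k \<le> length w" for k
    using that
  proof (induction k rule: dec_induct)
    case (step k)
    then show ?case using assms(1) unfolding admissible_def
      by (metis Suc_le_lessD le_trans less_imp_le)
  qed simp
  then show ?thesis using i by simp
qed

text \<open>The total alone does not survive appending a letter, so the induction also tracks the
  parity of the last letter. Unless the word ends in an ascent within its block, the sign of the
  last letter is free and both parities occur equally often. A new nonzero block doubles the count,
  an ascent within a block keeps it and makes the last sign positive, and a descent within a block
  keeps it or, directly after such an ascent, makes it zero.\<close>

lemma card_enriched_aux:
  assumes "length p = length w" "\<And>a. a \<in> set w \<Longrightarrow> 0 < a" "distinct w"
  shows "card {f \<in> enriched p w. even (val f (length w))} +
           card {f \<in> enriched p w. odd (val f (length w))} =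
           (if admissible p w then 2 ^ card (set p - {0}) else 0) \<and>
         (if rising_end p w then card {f \<in> enriched p w. odd (val f (length w))} = 0
          else card {f \<in> enriched p w. even (val f (length w))} =
               card {f \<in> enriched p w. odd (val f (length w))})"
  using assms
proof (induction w arbitrary: p rule: rev_induct)
  case Nil
  have *: "enriched [] [] = {[]}" by (auto simp: enriched_def ecompat_def)
  have "{f. f = [] \<and> even (val f 0)} = {[]}" by auto
  with Nil show ?case by (auto simp: * admissible_def rising_end_def)
next
  case (snoc a w pj)
  from snoc.prems(1) obtain p j where pj: "pj = p @ [j]" and len: "length p = length w"
    by (cases pj rule: rev_cases) auto
  define n where "n = length w"
  define k where "k = val p n"
  define asc where "asc \<longleftrightarrow> val w n < a"
  define E where "E = {f \<in> enriched p w. even (val f n)}"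
  define O' where "O' = {f \<in> enriched p w. odd (val f n)}"
  have EO: "E \<inter> O' = {}" "E \<union> O' = enriched p w" by (auto simp: E_def O'_def)
  have fin: "finite E" "finite O'" by (simp_all add: E_def O'_def)
  have tot: "card (enriched p w) = card E + card O'"
    using card_Un_disjoint[OF fin EO(1)] by (simp add: EO)
  have IH: "card E + card O' = (if admissible p w then 2 ^ card (set p - {0}) else 0)"
      "if rising_end p w then card O' = 0 else card E = card O'"
    using snoc.IH[OF len] snoc.prems(2,3) unfolding E_def O'_def n_def by auto
  have ne: "val w n \<noteq> a"
    using snoc.prems(2)[of a] snoc.prems(3) by (cases w rule: rev_cases) (auto simp: n_def)
  have blk_last: "blk (val f n) = k" "length f = n" if "f \<in> enriched p w" for f
  proof -
    have "length f = n" "map blk f = p"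
      using that by (auto simp: enriched_def ecompat_def n_def)
    then show "blk (val f n) = k" "length f = n" by (auto simp: k_def simp flip: val_map_blk)
  qed
  \<comment> \<open>Within a block, \<open>+j\<close> may follow \<open>-j\<close> over any step of
    \<open>w\<close>, but may follow \<open>+j\<close> only over an ascent.\<close>
  have ev: "{f \<in> enriched pj (w @ [a]). even (val f (Suc n))} =
      (\<lambda>f. f @ [2 * j]) ` {f \<in> enriched p w. k < j \<or> k = j \<and> (asc \<or> odd (val f n))}" (is "?A = ?B")
  proof (intro equalityI subsetI)
    fix f' assume f': "f' \<in> ?A"
    then obtain f l where f: "f' = f @ [l]" "length f = n"
      by (cases f' rule: rev_cases) (auto simp: enriched_def ecompat_def n_def)
    with f' have "even l" "blk l = j" and mem: "f \<in> enriched p w"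
      and c: "val f n < l \<or> val f n = l \<and> (if even l then val w n < a else a < val w n)"
      by (auto simp: enriched_def ecompat_snoc pj n_def nth_append)
    then have "l = 2 * j" by (auto simp: blk_def)
    moreover have "k < j \<or> k = j \<and> (asc \<or> odd (val f n))"
      using c blk_last(1)[OF mem] \<open>l = 2 * j\<close> by (auto simp: blk_def asc_def)
    ultimately show "f' \<in> ?B" using f mem by auto
  next
    fix f' assume "f' \<in> ?B"
    then obtain f where f: "f' = f @ [2 * j]" "f \<in> enriched p w" "k < j \<or> k = j \<and> (asc \<or> odd (val f n))"
      by auto
    then have "val f n < 2 * j \<or> val f n = 2 * j \<and> val w n < a"
      using blk_last(1)[OF f(2)] by (auto simp: blk_def asc_def)
    then show "f' \<in> ?A"
      using f blk_last(2)[OF f(2)] by (auto simp: enriched_def ecompat_snoc pj n_def nth_append blk_def)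
  qed
  \<comment> \<open>Within a block, \<open>-j\<close> can only follow \<open>-j\<close>, and only
    over a descent. For \<open>j = 0\<close> both sides are empty, since a letter with absolute
    value \<open>0\<close> is even.\<close>
  have od: "{f \<in> enriched pj (w @ [a]). odd (val f (Suc n))} =
      (\<lambda>f. f @ [2 * j - 1]) ` {f \<in> enriched p w. k < j \<or> k = j \<and> \<not> asc \<and> odd (val f n)}" (is "?A = ?B")
  proof (intro equalityI subsetI)
    fix f' assume f': "f' \<in> ?A"
    then obtain f l where f: "f' = f @ [l]" "length f = n"
      by (cases f' rule: rev_cases) (auto simp: enriched_def ecompat_def n_def)
    with f' have "odd l" "blk l = j" and mem: "f \<in> enriched p w"
      and c: "val f n < l \<or> val f n = l \<and> (if even l then val w n < a else a < val w n)"
      by (auto simp: enriched_def ecompat_snoc pj n_def nth_append)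
    then have l: "l = 2 * j - 1" "j > 0" by (auto simp: blk_def elim: oddE)
    moreover have "k < j \<or> k = j \<and> \<not> asc \<and> odd (val f n)"
      using c blk_last(1)[OF mem] l by (auto simp: blk_def asc_def)
    ultimately show "f' \<in> ?B" using f mem by auto
  next
    fix f' assume "f' \<in> ?B"
    then obtain f where f: "f' = f @ [2 * j - 1]" "f \<in> enriched p w" "k < j \<or> k = j \<and> \<not> asc \<and> odd (val f n)"
      by auto
    then have "j > 0"
      using blk_last(1)[OF f(2)] by (cases "j = 0") auto
    moreover have "val f n < 2 * j - 1 \<or> val f n = 2 * j - 1 \<and> a < val w n"
      using f(3) blk_last(1)[OF f(2)] ne \<open>j > 0\<close> by (auto simp: blk_def asc_def)
    ultimately show "f' \<in> ?A"
      using f blk_last(2)[OF f(2)] by (auto simp: enriched_def ecompat_snoc pj n_def nth_append blk_def)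
  qed
  have inj: "inj_on (\<lambda>f. f @ [x]) S" for x :: nat and S by (auto simp: inj_on_def)
  have E': "card {f \<in> enriched pj (w @ [a]). even (val f (Suc n))} =
      (if k < j then card E + card O' else if k = j then if asc then card E + card O' else card O' else 0)"
    unfolding ev card_image[OF inj]
    by (auto simp: tot simp flip: O'_def)
  have O'': "card {f \<in> enriched pj (w @ [a]). odd (val f (Suc n))} =
      (if k < j then card E + card O' else if k = j then if asc then 0 else card O' else 0)"
    unfolding od card_image[OF inj]
    by (auto simp: tot simp flip: O'_def)
  have adm: "admissible pj (w @ [a]) \<longleftrightarrow> admissible p w \<and> k \<le> j \<and>
     \<not> (w \<noteq> [] \<and> rising_end p w \<and> \<not> asc \<and> k = j)"
    using ne by (auto simp: pj admissible_snoc[OF len] k_def n_def asc_def)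
  have ris: "rising_end pj (w @ [a]) \<longleftrightarrow> k = j \<and> asc"
    using len by (auto simp: pj rising_end_def k_def asc_def n_def val_snoc nth_append)
  have asc0: asc if "w = []"
    using that snoc.prems(2)[of a] by (simp add: asc_def n_def)
  have new: "card (set pj - {0}) = Suc (card (set p - {0}))" if "admissible p w" "k < j"
  proof -
    have "j \<notin> set p" using admissible_le[OF that(1), of j] that(2) by (auto simp: k_def n_def)
    then have "set pj - {0} = insert j (set p - {0})" "j \<notin> set p - {0}" using that by (auto simp: pj)
    then show ?thesis by simp
  qed
  have old: "set pj - {0} = set p - {0}" if "k = j"
  proof -
    have "k = 0 \<or> k \<in> set p" using len by (cases n) (auto simp: k_def n_def)
    then show ?thesis using that by (auto simp: pj)
  qed
  consider "k < j" | "k = j" asc | "k = j" "\<not> asc" | "j < k" by linarith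
  then have "card {f \<in> enriched pj (w @ [a]). even (val f (Suc n))} +
           card {f \<in> enriched pj (w @ [a]). odd (val f (Suc n))} =
           (if admissible pj (w @ [a]) then 2 ^ card (set pj - {0}) else 0) \<and>
         (if rising_end pj (w @ [a]) then card {f \<in> enriched pj (w @ [a]). odd (val f (Suc n))} = 0
          else card {f \<in> enriched pj (w @ [a]). even (val f (Suc n))} =
               card {f \<in> enriched pj (w @ [a]). odd (val f (Suc n))})"
  proof cases
    case 1
    then show ?thesis using IH new unfolding E' O'' adm ris by auto
  next
    case 2
    then show ?thesis using IH old unfolding E' O'' adm ris by auto
  next
    case 3
    then show ?thesis using IH old asc0 unfolding E' O'' adm ris by (cases "rising_end p w") auto
  next
    case 4
    then show ?thesis unfolding E' O'' adm ris by auto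
  qed
  moreover have len_snoc: "length (w @ [a]) = Suc n" by (simp add: n_def)
  ultimately show ?case unfolding len_snoc by blast
qed

lemma card_enriched:
  assumes "length p = length w" "\<And>a. a \<in> set w \<Longrightarrow> 0 < a" "distinct w"
  shows "card (enriched p w) = (if admissible p w then 2 ^ card (set p - {0}) else 0)"
proof -
  have "enriched p w = {f \<in> enriched p w. even (val f (length w))} \<union>
      {f \<in> enriched p w. odd (val f (length w))}" by auto
  then have "card (enriched p w) = card {f \<in> enriched p w. even (val f (length w))} +
      card {f \<in> enriched p w. odd (val f (length w))}"
    by (subst card_Un_disjoint[symmetric]) (auto intro!: arg_cong[where f = card])
  then show ?thesis using card_enriched_aux[OF assms] by simp
qed

section \<open>The counts as functions of the peak set\<close>

lemma perms_props:
  assumes "w \<in> perms n"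
  shows "length w = n" "distinct w" "set w = {1..n}" "a \<in> set w \<Longrightarrow> 0 < a"
  using assms distinct_card[of w] by (auto simp: perms_def)

lemma admissible_Peak:
  assumes "w \<in> perms n"
  shows "admissible p w \<longleftrightarrow> length p = n \<and> (\<forall>i<n. val p i \<le> val p (Suc i)) \<and>
     (\<forall>i\<in>Peak n w. \<not> (val p (i - 1) = val p i \<and> val p i = val p (Suc i)))"
proof -
  have *: "(\<forall>i\<in>Peak n w. Q i) \<longleftrightarrow>
     (\<forall>j. Suc j < n \<longrightarrow> val w j < val w (Suc j) \<longrightarrow> val w (Suc (Suc j)) < val w (Suc j) \<longrightarrow> Q (Suc j))"
    (is "?l = ?r") for Q
  proof
    assume ?r
    show ?l
    proof
      fix i assume "i \<in> Peak n w"
      then show "Q i" using \<open>?r\<close> by (cases i) (auto simp: Peak_def)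
    qed
  qed (auto simp: Peak_def)
  show ?thesis
    unfolding * using perms_props(1)[OF assms] unfolding admissible_def by simp
qed

definition fp :: "nat list \<Rightarrow> nat list \<Rightarrow> rat" where
  "fp p w = of_nat (card (enriched p w))"

lemma fp_eq:
  assumes "w \<in> perms n"
  shows "fp p w = (if length p = n \<and> (\<forall>i<n. val p i \<le> val p (Suc i)) \<and>
     (\<forall>i\<in>Peak n w. \<not> (val p (i - 1) = val p i \<and> val p i = val p (Suc i)))
     then 2 ^ card (set p - {0}) else 0)"
proof (cases "length p = n")
  case True
  with card_enriched[of p w] perms_props[OF assms] admissible_Peak[OF assms, of p]
  show ?thesis by (auto simp: fp_def)
next
  case False
  then have "enriched p w = {}"
    using perms_props[OF assms] by (auto simp: enriched_def ecompat_def)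
  then show ?thesis using False by (simp add: fp_def)
qed

section \<open>Spanning sets\<close>

lemma finite_perms [simp]: "finite (perms n)"
proof -
  have "perms n \<subseteq> {u. set u \<subseteq> {1..n} \<and> length u = n}"
    using perms_props by auto
  then show ?thesis using finite_lists_length_eq[of "{1..n}" n] finite_subset by blast
qed

lemma finite_Fam [simp]: "finite (Fam n)"
  by (rule finite_subset[of _ "Pow {1..n-1}"]) (auto simp: Fam_def)

lemma finite_IFam [simp]: "finite (IFam n)"
  by (simp add: IFam_def)

lemma Peak_in_Fam: "Peak n w \<in> Fam n"
  by (auto simp: Peak_def Fam_def)

lemma IPeak_eq: "IPeak n w = Peak n w - {1}"
  by (auto simp: Peak_def IPeak_def)

lemma IPeak_in_IFam: "IPeak n w \<in> IFam n"
  using Peak_in_Fam[of n w] by (auto simp: IPeak_eq IFam_def Fam_def)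

lemma sum_mult_indicator:
  fixes f :: "'a \<Rightarrow> 'b :: semiring_1"
  assumes "finite A"
  shows "(\<Sum>a\<in>A. f a * (if b = a then 1 else 0)) = (if b \<in> A then f b else 0)"
proof -
  have "(\<Sum>a\<in>A. f a * (if b = a then 1 else 0)) = (\<Sum>a\<in>A. if b = a then f a else 0)"
    by (rule sum.cong) auto
  then show ?thesis using assms by simp
qed

text \<open>The spanning elements are indicators of the classes of \<open>pk\<close>, so their span
  consists of the functions constant on classes. This turns both span definitions into pointwise
  conditions.\<close>

lemma span_classes:
  fixes pk :: "nat list \<Rightarrow> nat set" and x :: "nat list \<Rightarrow> rat"
  assumes "finite \<F>" "\<And>w. pk w \<in> \<F>"
  shows "(\<exists>c. x = (\<lambda>w. \<Sum>F\<in>\<F>. c F * (if w \<in> perms n \<and> pk w = F then 1 else 0))) \<longleftrightarrow>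
    x \<in> ga n \<and> (\<forall>w\<in>perms n. \<forall>w'\<in>perms n. pk w = pk w' \<longrightarrow> x w = x w')" (is "?l \<longleftrightarrow> ?r")
proof -
  have *: "(\<Sum>F\<in>\<F>. c F * (if w \<in> perms n \<and> pk w = F then 1 else 0)) =
      (if w \<in> perms n then c (pk w) else 0)" for c :: "nat set \<Rightarrow> rat" and w
    using assms(2)[of w] by (cases "w \<in> perms n") (simp_all add: sum_mult_indicator[OF assms(1)])
  show ?thesis
  proof
    assume ?r
    \<comment> \<open>For a set \<open>F\<close> that is not attained this value is arbitrary, and
      the indicator multiplied by it vanishes.\<close>
    define c where "c F = x (SOME w. w \<in> perms n \<and> pk w = F)" for F
    have "x w = c (pk w)" if "w \<in> perms n" for w
    proof -
      have "(SOME w'. w' \<in> perms n \<and> pk w' = pk w) \<in> perms n \<and>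
          pk (SOME w'. w' \<in> perms n \<and> pk w' = pk w) = pk w"
        by (rule someI[of _ w]) (use that in auto)
      then show ?thesis using \<open>?r\<close> that unfolding c_def by metis
    qed
    moreover have "x w = 0" if "w \<notin> perms n" for w using \<open>?r\<close> that by (auto simp: ga_def)
    ultimately have "x = (\<lambda>w. if w \<in> perms n then c (pk w) else 0)" by auto
    then show ?l unfolding * by blast
  qed (auto simp: * ga_def)
qed

lemma peak_alg_iff:
  "x \<in> peak_alg n \<longleftrightarrow>
     x \<in> ga n \<and> (\<forall>w\<in>perms n. \<forall>w'\<in>perms n. Peak n w = Peak n w' \<longrightarrow> x w = x w')"
  unfolding peak_alg_def PF_def mem_Collect_eq by (rule span_classes) (simp_all add: Peak_in_Fam)

lemma peak_ideal_iff:
  "x \<in> peak_ideal n \<longleftrightarrow>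
     x \<in> ga n \<and> (\<forall>w\<in>perms n. \<forall>w'\<in>perms n. IPeak n w = IPeak n w' \<longrightarrow> x w = x w')"
  unfolding peak_ideal_def IPF_def mem_Collect_eq by (rule span_classes) (simp_all add: IPeak_in_IFam)

text \<open>A peak at position \<open>1\<close> is forbidden only if \<open>p\<close> continues the
  \<open>0\<close> in front of it. Without a letter \<open>0\<close> in \<open>p\<close> this cannot
  happen, so only the interior peaks impose conditions.\<close>

lemma fp_IPeak_cong:
  assumes "w \<in> perms n" "w' \<in> perms n" "IPeak n w = IPeak n w'" "0 \<notin> set p"
  shows "fp p w = fp p w'"
proof (cases "length p = n")
  case True
  have "(\<forall>i\<in>Peak n w. \<not> (val p (i - 1) = val p i \<and> val p i = val p (Suc i))) \<longleftrightarrow>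
      (\<forall>i\<in>IPeak n w. \<not> (val p (i - 1) = val p i \<and> val p i = val p (Suc i)))" for w
  proof -
    have "1 \<in> Peak n w \<Longrightarrow> val p 1 \<in> set p"
      using True by (auto simp: Peak_def val_def intro!: nth_mem)
    then have "1 \<in> Peak n w \<Longrightarrow> val p 0 \<noteq> val p 1" using assms(4) by (metis val_0)
    then show ?thesis unfolding IPeak_eq by auto
  qed
  then show ?thesis using assms by (simp only: fp_eq)
qed (use assms in \<open>simp add: fp_eq\<close>)

section \<open>Spans of counting functions and triangularity\<close>

definition fpwords :: "nat \<Rightarrow> nat list set" where
  "fpwords n = {p. length p = n \<and> set p \<subseteq> {..n}}"

lemma finite_fpwords [simp]: "finite (fpwords n)"
  using finite_lists_length_eq[of "{..n}" n] by (simp add: fpwords_def conj_commute)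

text \<open>Agreement is asked on \<open>perms n\<close> only, because \<open>fp p\<close> may be
  nonzero on lists that are not permutations.\<close>

definition fp_span :: "nat list set \<Rightarrow> nat \<Rightarrow> (nat list \<Rightarrow> rat) set" where
  "fp_span P n = {x. \<exists>\<alpha>. \<forall>w\<in>perms n. x w = (\<Sum>p\<in>P. \<alpha> p * fp p w)}"

lemma fp_spanI: "finite P \<Longrightarrow> p \<in> P \<Longrightarrow> fp p \<in> fp_span P n"
  unfolding fp_span_def
  by (auto intro!: exI[of _ "\<lambda>q. if p = q then 1 else 0"]
      simp: mult.commute[where a = "if _ then _ else _"] sum_mult_indicator)

lemma fp_span_scale: "x \<in> fp_span P n \<Longrightarrow> (\<lambda>w. c * x w) \<in> fp_span P n"
proof -
  assume "x \<in> fp_span P n"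
  then obtain \<alpha> where "\<forall>w\<in>perms n. x w = (\<Sum>p\<in>P. \<alpha> p * fp p w)" by (auto simp: fp_span_def)
  then show ?thesis unfolding fp_span_def
    by (auto intro!: exI[of _ "\<lambda>p. c * \<alpha> p"] simp: sum_distrib_left mult.assoc)
qed

lemma fp_span_add: "x \<in> fp_span P n \<Longrightarrow> y \<in> fp_span P n \<Longrightarrow> (\<lambda>w. x w + y w) \<in> fp_span P n"
proof -
  assume "x \<in> fp_span P n" "y \<in> fp_span P n"
  then obtain \<alpha> \<beta> where "\<forall>w\<in>perms n. x w = (\<Sum>p\<in>P. \<alpha> p * fp p w)"
    "\<forall>w\<in>perms n. y w = (\<Sum>p\<in>P. \<beta> p * fp p w)" by (auto simp: fp_span_def)
  then show ?thesis unfolding fp_span_def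
    by (auto intro!: exI[of _ "\<lambda>p. \<alpha> p + \<beta> p"] simp: sum.distrib distrib_right)
qed

lemma fp_span_zero: "(\<lambda>w. 0) \<in> fp_span P n"
  unfolding fp_span_def by (auto intro!: exI[of _ "\<lambda>p. 0"])

lemma fp_span_sum:
  "finite I \<Longrightarrow> (\<And>i. i \<in> I \<Longrightarrow> x i \<in> fp_span P n) \<Longrightarrow> (\<lambda>w. \<Sum>i\<in>I. x i w) \<in> fp_span P n"
proof (induction I rule: finite_induct)
  case (insert i I)
  have "(\<lambda>w. x i w + (\<Sum>i\<in>I. x i w)) \<in> fp_span P n"
    by (rule fp_span_add) (use insert in auto)
  with insert.hyps show ?case by simp
qed (simp add: fp_span_zero)

lemma fp_span_cong:
  "x \<in> fp_span P n \<Longrightarrow> (\<And>w. w \<in> perms n \<Longrightarrow> x w = y w) \<Longrightarrow> y \<in> fp_span P n"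
  by (auto simp: fp_span_def)

text \<open>Since \<open>G\<close> has no consecutive elements, moving each \<open>i \<in> G - F\<close> down to \<open>i - 1\<close> injects \<open>G\<close> into \<open>F\<close>.\<close>

lemma Fam_weight_less:
  assumes "F \<in> Fam n" "G \<in> Fam n" "G \<subseteq> F \<union> Suc ` F" "G \<noteq> F"
  shows "(\<Sum>i\<in>G. n - i) < (\<Sum>i\<in>F. n - i)"
proof -
  define \<pi> where "\<pi> i = (if i \<in> F then i else i - 1)" for i
  have fin: "finite F" "finite G" using assms(1,2) finite_subset by (auto simp: Fam_def)
  have bounds: "1 \<le> i" "i < n" if "i \<in> F \<union> G" for i
  proof -
    have "i \<in> {1..n-1}" using that assms(1,2) by (auto simp: Fam_def)
    then show "1 \<le> i" "i < n" by auto
  qed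
  have inj: "inj_on \<pi> G"
  proof (rule inj_onI)
    fix i j assume ij: "i \<in> G" "j \<in> G" "\<pi> i = \<pi> j"
    have "i + 1 \<notin> G" "j + 1 \<notin> G" using ij assms(2) by (auto simp: Fam_def)
    moreover have "1 \<le> i" "1 \<le> j" using ij bounds by auto
    moreover have "i = j \<or> i = j + 1 \<or> j = i + 1"
      using ij(3) \<open>1 \<le> i\<close> \<open>1 \<le> j\<close> by (auto simp: \<pi>_def split: if_splits)
    ultimately show "i = j" using ij by auto
  qed
  have sub: "\<pi> ` G \<subseteq> F" using assms(3) by (auto simp: \<pi>_def)
  have le: "n - i \<le> n - \<pi> i" for i by (auto simp: \<pi>_def)
  have im: "(\<Sum>i\<in>G. n - \<pi> i) = (\<Sum>i\<in>\<pi> ` G. n - i)" using inj by (simp add: sum.reindex)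
  show ?thesis
  proof (cases "G \<subseteq> F")
    case True
    then obtain b where b: "b \<in> F - G" using assms(4) by auto
    then have "0 < n - b" using bounds[of b] by simp
    with b show ?thesis using True fin by (intro sum_strict_mono2[of F G b]) auto
  next
    case False
    then obtain i where i: "i \<in> G" "i \<notin> F" by auto
    have "n - i < n - \<pi> i" using i bounds[of i] by (auto simp: \<pi>_def)
    then have "(\<Sum>i\<in>G. n - i) < (\<Sum>i\<in>G. n - \<pi> i)"
      using fin le i by (intro sum_strict_mono_ex1) auto
    also have "\<dots> \<le> (\<Sum>i\<in>F. n - i)" unfolding im using sub fin by (intro sum_mono2) auto
    finally show ?thesis .
  qed
qed

text \<open>The function attached to \<open>F\<close> is a nonzero multiple of a sum of class
  indicators: that of \<open>F\<close> itself and others which have smaller weight by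
  \<open>Fam_weight_less\<close>. Induction on the weight therefore solves for each indicator, and
  \<open>x\<close> is a combination of indicators.\<close>

lemma triangular_span:
  assumes P: "finite P" and fin: "finite \<F>" and Fam: "\<F> \<subseteq> Fam n" and pk: "\<And>w. pk w \<in> \<F>"
    and p: "\<And>F. F \<in> \<F> \<Longrightarrow> \<exists>p\<in>P. \<exists>r\<noteq>0. \<forall>w\<in>perms n. fp p w = (if pk w \<subseteq> F \<union> Suc ` F then r else 0)"
    and x: "\<And>w w'. w \<in> perms n \<Longrightarrow> w' \<in> perms n \<Longrightarrow> pk w = pk w' \<Longrightarrow> x w = x w'"
  shows "x \<in> fp_span P n"
proof -
  let ?e = "\<lambda>F w. if pk w = F then 1 else 0 :: rat"
  have e: "?e F \<in> fp_span P n" if "F \<in> \<F>" for F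
    using that
  proof (induction "\<Sum>i\<in>F. n - i" arbitrary: F rule: less_induct)
    case less
    obtain q r where q: "q \<in> P" "r \<noteq> 0"
      "\<And>w. w \<in> perms n \<Longrightarrow> fp q w = (if pk w \<subseteq> F \<union> Suc ` F then r else 0)"
      using p[OF less.prems] by blast
    define S where "S = {G \<in> \<F>. G \<subseteq> F \<union> Suc ` F \<and> G \<noteq> F}"
    have "(\<lambda>w. 1 / r * fp q w + (-1) * (\<Sum>G\<in>S. ?e G w)) \<in> fp_span P n"
    proof (intro fp_span_add fp_span_scale fp_span_sum fp_spanI P q)
      fix G assume "G \<in> S"
      then show "?e G \<in> fp_span P n"
        using less.prems Fam by (intro less.hyps Fam_weight_less) (auto simp: S_def)
    qed (use fin in \<open>auto simp: S_def\<close>)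
    then show ?case
    proof (rule fp_span_cong)
      fix w assume w: "w \<in> perms n"
      have "finite S" using fin by (simp add: S_def)
      then have "(\<Sum>G\<in>S. ?e G w) = (if pk w \<in> S then 1 else 0)" by simp
      then show "1 / r * fp q w + (-1) * (\<Sum>G\<in>S. ?e G w) = ?e F w"
        using q(2) q(3)[OF w] pk[of w] by (auto simp: S_def)
    qed
  qed
  have "(\<lambda>w. \<Sum>F\<in>\<F>. x (SOME w. w \<in> perms n \<and> pk w = F) * ?e F w) \<in> fp_span P n"
    by (intro fp_span_sum fin fp_span_scale e)
  then show ?thesis
  proof (rule fp_span_cong)
    fix w assume w: "w \<in> perms n"
    have "(SOME w'. w' \<in> perms n \<and> pk w' = pk w) \<in> perms n \<and>
        pk (SOME w'. w' \<in> perms n \<and> pk w' = pk w) = pk w"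
      by (rule someI[of _ w]) (use w in auto)
    then have "x (SOME w'. w' \<in> perms n \<and> pk w' = pk w) = x w" using x w by blast
    then show "(\<Sum>F\<in>\<F>. x (SOME w. w \<in> perms n \<and> pk w = F) * ?e F w) = x w"
      using pk[of w] by (simp add: sum_mult_indicator[OF fin])
  qed
qed

lemma card_below_Suc:
  assumes "finite F"
  shows "card {j \<in> F. j < Suc i} = card {j \<in> F. j < i} + (if i \<in> F then 1 else 0)"
proof -
  have "{j \<in> F. j < Suc i} = (if i \<in> F then insert i {j \<in> F. j < i} else {j \<in> F. j < i})"
    by (auto simp: less_Suc_eq)
  then show ?thesis using assms by auto
qed

text \<open>Each element of \<open>F\<close> is the last position of a block of the word.\<close>

definition block_word :: "nat \<Rightarrow> nat \<Rightarrow> nat set \<Rightarrow> nat list" where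
  "block_word k n F = map (\<lambda>i. k + card {j \<in> F. j < Suc i}) [0..<n]"

lemma block_word:
  assumes F: "F \<in> Fam n"
  shows "block_word 0 n F \<in> fpwords n"
    and "block_word 1 n F \<in> fpwords n"
    and "0 \<notin> set (block_word 1 n F)"
    and "w \<in> perms n \<Longrightarrow> fp (block_word 0 n F) w =
           (if Peak n w \<subseteq> F \<union> Suc ` F then 2 ^ card (set (block_word 0 n F) - {0}) else 0)"
    and "w \<in> perms n \<Longrightarrow> fp (block_word 1 n F) w =
           (if IPeak n w \<subseteq> F \<union> Suc ` F then 2 ^ card (set (block_word 1 n F) - {0}) else 0)"
proof -
  have fin: "finite F" and sub: "F \<subseteq> {1..n-1}" using F finite_subset by (auto simp: Fam_def)
  have le: "Suc (card {j \<in> F. j < i}) \<le> n" if "n > 0" for i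
  proof -
    have "card {j \<in> F. j < i} \<le> card {1..n-1}" using sub by (intro card_mono) auto
    then show ?thesis using that by simp
  qed
  show "block_word 0 n F \<in> fpwords n" "block_word 1 n F \<in> fpwords n" "0 \<notin> set (block_word 1 n F)"
    using le Suc_leD[OF le] by (auto simp: block_word_def fpwords_def)
  have v: "val (block_word k n F) i = (if i = 0 then 0 else k + card {j \<in> F. j < i})" if "i \<le> n" for i k
    using that by (cases i) (auto simp: block_word_def)
  have v0: "{j \<in> F. j < Suc 0} = {}" using sub by auto
  have mono: "val (block_word k n F) i \<le> val (block_word k n F) (Suc i)" if "i < n" for k i
    using that card_below_Suc[OF fin, of i] by (simp add: v del: val_Suc)
  have eq: "val (block_word k n F) i = val (block_word k n F) (Suc i) \<longleftrightarrow> (if i = 0 then k = 0 else i \<notin> F)"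
    if "i < n" for k i
    using that card_below_Suc[OF fin, of i] v0 by (auto simp: v simp del: val_Suc)
  have bad: "val (block_word k n F) (i - 1) = val (block_word k n F) i \<and>
      val (block_word k n F) i = val (block_word k n F) (Suc i) \<longleftrightarrow>
      (i = 1 \<longrightarrow> k = 0) \<and> i \<notin> F \<union> Suc ` F" if i: "i \<in> {1..n-1}" for k i
  proof -
    obtain i' where i': "i = Suc i'" using i by (cases i) simp_all
    then show ?thesis using i eq[of i' k] eq[of i k] sub by (auto simp del: val_Suc)
  qed
  have len: "length (block_word k n F) = n" for k by (simp add: block_word_def)
  {
    assume w: "w \<in> perms n"
    have Pk: "Peak n w \<subseteq> {1..n-1}" "IPeak n w = Peak n w - {1}"
      by (auto simp: Peak_def IPeak_eq)
    have "(\<forall>i\<in>Peak n w. \<not> (val (block_word k n F) (i - 1) = val (block_word k n F) i \<and>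
      val (block_word k n F) i = val (block_word k n F) (Suc i))) \<longleftrightarrow>
      (\<forall>i\<in>Peak n w. \<not> ((i = 1 \<longrightarrow> k = 0) \<and> i \<notin> F \<union> Suc ` F))" for k
      using Pk(1) bad by (intro ball_cong) blast+
    then have *: "fp (block_word k n F) w = (if (\<forall>i\<in>Peak n w. \<not> ((i = 1 \<longrightarrow> k = 0) \<and> i \<notin> F \<union> Suc ` F))
        then 2 ^ card (set (block_word k n F) - {0}) else 0)" for k
      unfolding fp_eq[OF w] using mono len by simp
    show "fp (block_word 0 n F) w =
           (if Peak n w \<subseteq> F \<union> Suc ` F then 2 ^ card (set (block_word 0 n F) - {0}) else 0)"
      unfolding * by (rule if_cong) auto
    show "fp (block_word 1 n F) w =
           (if IPeak n w \<subseteq> F \<union> Suc ` F then 2 ^ card (set (block_word 1 n F) - {0}) else 0)"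
      unfolding * Pk by (rule if_cong) auto
  }
qed

lemma peak_alg_span:
  assumes "x \<in> peak_alg n"
  shows "x \<in> fp_span (fpwords n) n"
proof (rule triangular_span[where \<F> = "Fam n" and pk = "Peak n"])
  fix F assume F: "F \<in> Fam n"
  have "\<forall>w\<in>perms n. fp (block_word 0 n F) w =
      (if Peak n w \<subseteq> F \<union> Suc ` F then 2 ^ card (set (block_word 0 n F) - {0}) else 0)"
    using block_word(4)[OF F] by blast
  moreover have "2 ^ card (set (block_word 0 n F) - {0}) \<noteq> (0 :: rat)" by simp
  ultimately show "\<exists>p\<in>fpwords n. \<exists>r\<noteq>0. \<forall>w\<in>perms n. fp p w = (if Peak n w \<subseteq> F \<union> Suc ` F then r else 0)"
    using block_word(1)[OF F] by blast
next
  show "x w = x w'" if "w \<in> perms n" "w' \<in> perms n" "Peak n w = Peak n w'" for w w'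
    using that assms unfolding peak_alg_iff by blast
qed (simp_all add: Peak_in_Fam)

lemma peak_ideal_span:
  assumes "x \<in> peak_ideal n"
  shows "x \<in> fp_span {p \<in> fpwords n. 0 \<notin> set p} n"
proof (rule triangular_span[where \<F> = "IFam n" and pk = "IPeak n"])
  fix F assume "F \<in> IFam n"
  then have F: "F \<in> Fam n" by (simp add: IFam_def)
  have "\<forall>w\<in>perms n. fp (block_word 1 n F) w =
      (if IPeak n w \<subseteq> F \<union> Suc ` F then 2 ^ card (set (block_word 1 n F) - {0}) else 0)"
    using block_word(5)[OF F] by blast
  moreover have "2 ^ card (set (block_word 1 n F) - {0}) \<noteq> (0 :: rat)" by simp
  ultimately show "\<exists>p\<in>{p \<in> fpwords n. 0 \<notin> set p}. \<exists>r\<noteq>0. \<forall>w\<in>perms n. fp p w = (if IPeak n w \<subseteq> F \<union> Suc ` F then r else 0)"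
    using block_word(2,3)[OF F] by blast
next
  show "x w = x w'" if "w \<in> perms n" "w' \<in> perms n" "IPeak n w = IPeak n w'" for w w'
    using that assms unfolding peak_ideal_iff by blast
  show "IPeak n w \<in> IFam n" for w by (rule IPeak_in_IFam)
  show "IFam n \<subseteq> Fam n" by (auto simp: IFam_def)
qed simp_all

section \<open>Product alphabets and standardization\<close>

text \<open>For \<open>x < M\<close> this is the position of the pair with outer letter
  \<open>g\<close> and inner letter \<open>x\<close> in the lexicographic order that is reversed
  inside odd \<open>g\<close>. If \<open>M\<close> is odd, the sign of the code is the product of
  the signs of \<open>g\<close> and \<open>x\<close>.\<close>

definition bcode :: "nat \<Rightarrow> nat \<Rightarrow> nat \<Rightarrow> nat" where
  "bcode M g x = g * M + (if even g then x else M - 1 - x)"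

definition bdig :: "nat \<Rightarrow> nat \<Rightarrow> nat" where
  "bdig M c = (if even (c div M) then c mod M else M - 1 - c mod M)"

lemma bcode_div: "x < M \<Longrightarrow> bcode M g x div M = g"
  by (auto simp: bcode_def)

lemma bdig_bcode:
  assumes "x < M"
  shows "bdig M (bcode M g x) = x"
proof -
  have "bcode M g x mod M = (if even g then x else M - 1 - x)"
    using assms by (simp add: bcode_def)
  then show ?thesis using assms by (auto simp: bdig_def bcode_div)
qed

lemma bdig_less: "M > 0 \<Longrightarrow> bdig M c < M"
  by (auto simp: bdig_def)

lemma bcode_bdig: "M > 0 \<Longrightarrow> bcode M (c div M) (bdig M c) = c"
proof -
  assume M: "M > 0"
  then have "c mod M < M" by simp
  then have "M - 1 - (M - 1 - c mod M) = c mod M" by linarith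
  then show ?thesis by (simp add: bcode_def bdig_def)
qed

lemma bcode_mono:
  assumes "x < M" "y < M" "g < g'"
  shows "bcode M g x < bcode M g' y"
proof -
  have "bcode M g x < (g + 1) * M" using assms by (auto simp: bcode_def)
  also have "\<dots> \<le> g' * M" using assms by (intro mult_right_mono) auto
  also have "\<dots> \<le> bcode M g' y" by (simp add: bcode_def)
  finally show ?thesis .
qed

lemma bcode_less_iff:
  assumes "x < M" "y < M"
  shows "bcode M g x < bcode M g' y \<longleftrightarrow> g < g' \<or> g = g' \<and> (if even g then x < y else y < x)"
proof (cases g g' rule: linorder_cases)
  case equal
  then show ?thesis using assms by (auto simp: bcode_def)
qed (use bcode_mono[of x M y g g'] bcode_mono[of y M x g' g] assms in auto)

lemma bcode_inj:
  assumes "x < M" "y < M" "bcode M g x = bcode M g' y"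
  shows "g = g' \<and> x = y"
  using assms bcode_div bdig_bcode by metis

text \<open>Reversing the inner order on odd letters makes the lexicographic code associative
  as long as the middle alphabet has odd size.\<close>

lemma bcode_assoc:
  assumes "odd M" "x < M" "a < N"
  shows "bcode N (bcode M g x) a = bcode (M * N) g (bcode N x a)"
proof (cases "even g")
  case True
  then show ?thesis using assms by (auto simp: bcode_def algebra_simps)
next
  case False
  obtain y where y: "M = x + y + 1" using less_imp_Suc_add[OF assms(2)] by auto
  obtain b where b: "N = a + b + 1" using less_imp_Suc_add[OF assms(3)] by auto
  have "even x \<longleftrightarrow> even y" using assms(1) y by auto
  moreover have "x * N + a < M * N" "x * N + b < M * N" using y b by (auto simp: algebra_simps)
  ultimately show ?thesis using False assms(1)
    by (auto simp: bcode_def y b algebra_simps)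
qed

text \<open>An odd code \<open>h\<close> and its successor have the same absolute value. Passing
  from \<open>h\<close> to \<open>h + 1\<close> changes the sign of exactly one of the two letters
  and keeps both absolute values, so these can be read off from \<open>blk h\<close>.\<close>

lemma blk_decode:
  assumes "odd M"
  shows "blk (h div M) = blk (2 * blk h div M)" "blk (bdig M h) = blk (bdig M (2 * blk h))"
proof -
  have M: "M > 0" using assms by (auto intro: Nat.gr0I)
  have "blk (h div M) = blk (2 * blk h div M) \<and> blk (bdig M h) = blk (bdig M (2 * blk h))"
  proof (cases "even h")
    case True
    then show ?thesis by (simp add: blk_def)
  next
    case False
    then have h: "2 * blk h = Suc h" by (simp add: blk_def)
    define g x where "g = h div M" and "x = bdig M h"
    have hx: "h = bcode M g x" "x < M" using M by (auto simp: g_def x_def bcode_bdig bdig_less)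
    \<comment> \<open>The code is negative, so exactly one of the letters \<open>g\<close> and
      \<open>x\<close> is negative.\<close>
    have par: "odd (g + x)"
    proof -
      have "odd (bcode M g x)" using False hx by simp
      moreover obtain y where "M = x + y + 1" using less_imp_Suc_add[OF hx(2)] by auto
      ultimately show ?thesis using assms by (auto simp: bcode_def split: if_splits)
    qed
    have "Suc h = (if even g then bcode M g (x + 1) else if x = 0 then bcode M (g + 1) 0 else bcode M g (x - 1))
        \<and> (even g \<longrightarrow> x + 1 < M)"
    proof (cases "even g")
      case True
      then have "odd x" using par by simp
      then have "x + 1 \<noteq> M" using assms by auto
      then show ?thesis using True hx by (auto simp: bcode_def)
    next
      case False
      then show ?thesis using hx by (auto simp: bcode_def)
    qed
    \<comment> \<open>If \<open>g\<close> is odd and \<open>x = 0\<close>, the successor carries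
      over to the pair of \<open>g + 1\<close> and \<open>0\<close>; the truncated difference
      \<open>x - 1\<close> gives this inner letter as well.\<close>
    then have "Suc h div M = (if even g then g else if x = 0 then g + 1 else g) \<and>
       bdig M (Suc h) = (if even g then x + 1 else x - 1)"
      using hx(2) M by (auto simp: bcode_div bdig_bcode split: if_splits)
    then show ?thesis using par unfolding h g_def[symmetric] x_def[symmetric]
      by (auto simp: blk_def elim!: oddE evenE)
  qed
  then show "blk (h div M) = blk (2 * blk h div M)" "blk (bdig M h) = blk (bdig M (2 * blk h))" by auto
qed

section \<open>Compatibility as sortedness, and standardization\<close>

lemma ecompat_pos:
  assumes "\<And>a. a \<in> set w \<Longrightarrow> 0 < a"
  shows "ecompat f w \<longleftrightarrow> length f = length w \<and>
     (\<forall>i. Suc i < length w \<longrightarrow> f ! i < f ! Suc i \<or>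
        f ! i = f ! Suc i \<and> (if even (f ! i) then w ! i < w ! Suc i else w ! Suc i < w ! i))"
proof -
  have all_split: "(\<forall>i<m. P i) \<longleftrightarrow> (0 < m \<longrightarrow> P 0) \<and> (\<forall>i. Suc i < m \<longrightarrow> P (Suc i))" for m and P :: "nat \<Rightarrow> bool"
    by (metis gr0_implies_Suc not_gr_zero)
  \<comment> \<open>The step from the \<open>0\<close> in front to the first letter is an ascent of
    \<open>w\<close>, so the condition there always holds.\<close>
  have "0 < length w \<Longrightarrow> 0 < w ! 0" using assms by simp
  then show ?thesis
    unfolding ecompat_def all_split[of "length w"] val_Suc val_0 by (auto simp del: length_greater_0_conv)
qed

text \<open>The sign rule for equal letters of \<open>f\<close> is exactly the reversal built into
  the code, applied to pairs with a letter of \<open>w\<close> inside.\<close>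

lemma ecompat_iff_sorted:
  assumes len: "length f = length w" and w: "\<And>a. a \<in> set w \<Longrightarrow> 0 < a \<and> a < N"
  shows "ecompat f w \<longleftrightarrow> sorted_wrt (<) (map2 (bcode N) f w)"
proof -
  have "ecompat f w \<longleftrightarrow> (\<forall>i. Suc i < length w \<longrightarrow> bcode N (f ! i) (w ! i) < bcode N (f ! Suc i) (w ! Suc i))"
    using len w by (subst ecompat_pos) (auto simp: bcode_less_iff)
  also have "\<dots> \<longleftrightarrow> sorted_wrt (<) (map2 (bcode N) f w)"
    using len by (subst sorted_wrt_iff_nth_Suc_transp) (auto simp: transp_on_def)
  finally show ?thesis .
qed

lemma nth_pcomp: "i < length v \<Longrightarrow> pcomp u v ! i = u ! (v ! i - 1)"
  by (simp add: pcomp_def)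

lemma length_pcomp [simp]: "length (pcomp u v) = length v"
  by (simp add: pcomp_def)

lemma perms_nth:
  assumes "v \<in> perms n" "i < n"
  shows "1 \<le> v ! i" "v ! i \<le> n" "v ! i - 1 < n"
proof -
  have "v ! i \<in> set v" using assms perms_props(1)[OF assms(1)] by simp
  then show "1 \<le> v ! i" "v ! i \<le> n" "v ! i - 1 < n" using perms_props(3)[OF assms(1)] by auto
qed

lemma perms_mset_iff: "w \<in> perms n \<longleftrightarrow> mset w = mset [1..<Suc n]"
proof
  assume w: "w \<in> perms n"
  show "mset w = mset [1..<Suc n]"
    using set_eq_iff_mset_eq_distinct[of w "[1..<Suc n]"] perms_props(2,3)[OF w]
    by (simp add: atLeastLessThanSuc_atLeastAtMost del: upt_Suc)
next
  assume w: "mset w = mset [1..<Suc n]"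
  then have "set w = {1..n}" using mset_eq_setD[OF w] by auto
  moreover have "distinct w" using mset_eq_imp_distinct_iff[OF w] by simp
  ultimately show "w \<in> perms n" by (simp add: perms_def)
qed

lemma mset_pcomp:
  assumes "v \<in> perms n" "length f = n"
  shows "mset (pcomp f v) = mset f"
proof -
  have "mset v = mset [1..<Suc n]"
    using assms(1) by (simp only: perms_mset_iff)
  then have "mset (pcomp f v) = mset (map (\<lambda>i. f ! (i - 1)) [1..<Suc n])"
    by (simp add: pcomp_def)
  also have "map (\<lambda>i. f ! (i - 1)) [1..<Suc n] = f"
    using assms(2) by (intro nth_equalityI) (simp_all del: upt_Suc)
  finally show ?thesis .
qed

text \<open>Sorting the pairs of letters of \<open>X\<close> and \<open>w\<close> by their code
  gives \<open>f\<close> and \<open>u\<close> as the two components, and \<open>v\<close> records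
  the place of each original pair in the sorted list.\<close>

lemma standardize_ex:
  assumes w: "w \<in> perms n" and X: "length X = n"
  shows "\<exists>u\<in>perms n. \<exists>v\<in>perms n. \<exists>f. ecompat f u \<and> pcomp u v = w \<and> pcomp f v = X"
proof -
  define key where "key = (\<lambda>(x, a). bcode (Suc n) x a)"
  define L where "L = sort_key key (zip X w)"
  have mL: "mset L = mset (zip X w)" by (simp add: L_def)
  have lens: "length L = n" "length w = n" using X perms_props(1)[OF w] by (simp_all add: L_def)
  have "image_mset snd (mset L) = mset w" unfolding mL using X lens by (simp flip: mset_map)
  then have u: "map snd L \<in> perms n" using w by (simp add: perms_mset_iff)
  have inj: "inj_on key (set (zip X w))"
  proof (rule inj_onI)
    fix s t assume st: "s \<in> set (zip X w)" "t \<in> set (zip X w)" "key s = key t"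
    then have "snd s \<in> set w" "snd t \<in> set w" by (metis prod.collapse set_zip_rightD)+
    then have "snd s < Suc n" "snd t < Suc n" using perms_props(3)[OF w] by auto
    then have "fst s = fst t \<and> snd s = snd t"
      using st(3) by (intro bcode_inj[of _ "Suc n"]) (simp_all add: key_def split_beta)
    then show "s = t" by (simp add: prod_eq_iff)
  qed
  have "distinct (zip X w)" using perms_props(2)[OF w] by (rule distinct_zipI2)
  then have "distinct L" "set L = set (zip X w)" by (simp_all add: L_def)
  then have "sorted_wrt (<) (map key L)"
    using inj by (simp add: strict_sorted_iff distinct_map) (simp add: L_def)
  moreover have "map key L = map2 (bcode (Suc n)) (map fst L) (map snd L)"
    by (simp add: key_def zip_map_fst_snd)
  ultimately have e: "ecompat (map fst L) (map snd L)"
    using perms_props(3)[OF u] by (subst ecompat_iff_sorted[where N = "Suc n"]) auto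
  \<comment> \<open>The map \<open>\<pi>\<close> sends a position of \<open>w\<close> to its place
    in the sorted list, counted from \<open>0\<close>; adding \<open>1\<close> turns it into the
    one-line notation \<open>v\<close>.\<close>
  obtain \<pi> where \<pi>: "\<pi> permutes {..<n}" "permute_list \<pi> L = zip X w"
    using mset_eq_permutation[OF mL[symmetric]] lens by auto
  define v where "v = map (\<lambda>i. Suc (\<pi> i)) [0..<n]"
  have "bij_betw \<pi> {..<n} {..<n}" using \<pi>(1) permutes_imp_bij by blast
  then have im: "\<pi> ` {..<n} = {..<n}" "inj_on \<pi> {..<n}" by (auto simp: bij_betw_def)
  have "set v = Suc ` (\<pi> ` {..<n})" by (auto simp: v_def atLeast0LessThan)
  then have "set v = {1..n}" unfolding im(1) by (auto simp: image_Suc_lessThan)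
  moreover have "distinct v" using im(2)
    by (auto simp: v_def distinct_map atLeast0LessThan inj_on_def)
  ultimately have v: "v \<in> perms n" by (simp add: perms_def)
  have nth: "L ! \<pi> i = (X ! i, w ! i)" if "i < n" for i
    using that \<pi> lens X by (metis length_map length_zip min.idem nth_zip permute_list_nth)
  have less: "\<pi> i < n" if "i < n" for i using im(1) that by blast
  have "pcomp (map snd L) v = w" "pcomp (map fst L) v = X"
    using lens X by (auto simp: list_eq_iff_nth_eq nth_pcomp v_def less nth)
  with u v e show ?thesis by blast
qed

lemma pcomp_code:
  assumes "v \<in> perms n" "length f = n" "length u = n"
  shows "map2 (bcode N) (pcomp f v) (pcomp u v) = pcomp (map2 (bcode N) f u) v"
  using assms perms_props(1)[OF assms(1)] perms_nth[OF assms(1)]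
  by (auto simp: list_eq_iff_nth_eq nth_pcomp)

lemma ecompat_code:
  assumes "ecompat f u" "u \<in> perms n"
  shows "sorted_wrt (<) (map2 (bcode (Suc n)) f u)" "length f = n"
proof -
  show "length f = n" using assms perms_props(1)[OF assms(2)] by (simp add: ecompat_def)
  then show "sorted_wrt (<) (map2 (bcode (Suc n)) f u)"
    using assms perms_props[OF assms(2)] ecompat_iff_sorted[of f u "Suc n"] by auto
qed

text \<open>The pairs of \<open>f\<close> and \<open>u\<close> form a strictly sorted list, and this
  list is determined by its multiset, which is also that of the pairs of \<open>pcomp f v\<close>
  and \<open>pcomp u v\<close>. As \<open>u\<close> has no repeated letters, \<open>v\<close>
  follows.\<close>

lemma standardize_unique:
  assumes "u \<in> perms n" "v \<in> perms n" "ecompat f u"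
      and "u' \<in> perms n" "v' \<in> perms n" "ecompat f' u'"
      and "pcomp u v = pcomp u' v'" "pcomp f v = pcomp f' v'"
  shows "u = u' \<and> v = v' \<and> f = f'"
proof -
  note s = ecompat_code[OF assms(3,1)] and s' = ecompat_code[OF assms(6,4)]
  note l = perms_props(1)[OF assms(1)] perms_props(1)[OF assms(2)]
           perms_props(1)[OF assms(4)] perms_props(1)[OF assms(5)]
  let ?N = "Suc n"
  have "mset (map2 (bcode ?N) f u) = mset (map2 (bcode ?N) (pcomp f v) (pcomp u v))"
    unfolding pcomp_code[OF assms(2) s(2) l(1)] using assms(2) l s by (subst mset_pcomp) auto
  also have "\<dots> = mset (map2 (bcode ?N) f' u')"
    unfolding assms(7,8) pcomp_code[OF assms(5) s'(2) l(3)] using assms(5) l s' by (subst mset_pcomp) auto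
  finally have eq: "map2 (bcode ?N) f u = map2 (bcode ?N) f' u'"
    using s s' by (metis properties_for_sort strict_sorted_imp_sorted)
  have "f ! i = f' ! i \<and> u ! i = u' ! i" if "i < n" for i
  proof (rule bcode_inj)
    show "u ! i < ?N" "u' ! i < ?N" using that perms_nth assms(1,4) by (simp_all add: less_Suc_eq_le)
    show "bcode ?N (f ! i) (u ! i) = bcode ?N (f' ! i) (u' ! i)"
      using arg_cong[OF eq, of "\<lambda>L. L ! i"] that s s' l by simp
  qed
  then have fu: "f = f'" "u = u'" using s s' l by (auto intro: nth_equalityI)
  have "v ! i = v' ! i" if "i < n" for i
  proof -
    have "u ! (v ! i - 1) = u ! (v' ! i - 1)"
      using arg_cong[OF assms(7), of "\<lambda>L. L ! i"] that l fu by (simp add: nth_pcomp)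
    then have "v ! i - 1 = v' ! i - 1"
      using perms_props(2)[OF assms(1)] perms_nth[OF assms(2) that] perms_nth[OF assms(5) that] l
      by (simp add: nth_eq_iff_index_eq)
    then show ?thesis using perms_nth[OF assms(2) that] perms_nth[OF assms(5) that] by linarith
  qed
  then show ?thesis using fu l by (auto intro: nth_equalityI)
qed

text \<open>Since the codes of \<open>f\<close> over \<open>u\<close> increase, comparing letters of
  \<open>v\<close> amounts to comparing codes of \<open>X\<close> over \<open>w\<close>. Both sides
  then compare triples made of letters of \<open>g\<close>, \<open>X\<close> and \<open>w\<close>,
  bracketed in two ways that \<open>bcode_assoc\<close> identifies.\<close>

lemma ecompat_product:
  assumes u: "u \<in> perms n" and v: "v \<in> perms n" and e: "ecompat f u"
    and X: "X = pcomp f v" and w: "w = pcomp u v" "w \<in> perms n"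
    and M: "odd M" "\<And>x. x \<in> set X \<Longrightarrow> x < M" and g: "length g = n"
  shows "ecompat g v \<longleftrightarrow> ecompat (map2 (bcode M) g X) w"
proof -
  let ?N = "Suc n"
  note s = ecompat_code[OF e u]
  have l: "length u = n" "length v = n" "length X = n" "length w = n"
    using perms_props(1) u v w X by auto
  define k where "k = map2 (bcode ?N) f u"
  have k: "bcode ?N (X ! i) (w ! i) = k ! (v ! i - 1)" if "i < n" for i
    using that l s perms_nth[OF v that] by (simp add: k_def X w nth_pcomp)
  have lk: "length k = n" "sorted_wrt (<) k" using s l by (simp_all add: k_def)
  have ord: "v ! i < v ! j \<longleftrightarrow> bcode ?N (X ! i) (w ! i) < bcode ?N (X ! j) (w ! j)" if "i < n" "j < n" for i j
  proof -
    have "k ! a < k ! b \<longleftrightarrow> a < b" if "a < n" "b < n" for a b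
      using sorted_wrt_nth_less[OF lk(2)] that lk(1) by (metis less_asym linorder_neqE_nat)
    then show ?thesis
      using perms_nth[OF v that(1)] perms_nth[OF v that(2)] by (auto simp: k that)
  qed
  have wN: "w ! i < ?N" "X ! i < M" if "i < n" for i
    using that perms_nth[OF w(2)] M(2) l by (auto simp: less_Suc_eq_le)
  have kN: "bcode ?N (X ! i) (w ! i) < M * ?N" if "i < n" for i
  proof -
    have "bcode ?N (X ! i) (w ! i) < (X ! i + 1) * ?N" using wN[OF that] by (auto simp: bcode_def)
    also have "\<dots> \<le> M * ?N" using wN[OF that] by (intro mult_right_mono) auto
    finally show ?thesis .
  qed
  have "(g ! i < g ! j \<or> g ! i = g ! j \<and> (if even (g ! i) then v ! i < v ! j else v ! j < v ! i)) \<longleftrightarrow>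
     (map2 (bcode M) g X ! i < map2 (bcode M) g X ! j \<or> map2 (bcode M) g X ! i = map2 (bcode M) g X ! j \<and>
       (if even (map2 (bcode M) g X ! i) then w ! i < w ! j else w ! j < w ! i))" (is "?l \<longleftrightarrow> ?r")
    if "i < n" "j < n" for i j
  proof -
    have "?l \<longleftrightarrow> bcode (M * ?N) (g ! i) (bcode ?N (X ! i) (w ! i)) < bcode (M * ?N) (g ! j) (bcode ?N (X ! j) (w ! j))"
      using kN that ord by (simp add: bcode_less_iff)
    also have "\<dots> \<longleftrightarrow> bcode ?N (bcode M (g ! i) (X ! i)) (w ! i) < bcode ?N (bcode M (g ! j) (X ! j)) (w ! j)"
      using wN that M by (simp add: bcode_assoc)
    also have "\<dots> \<longleftrightarrow> ?r" using wN that l g by (simp add: bcode_less_iff)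
    finally show ?thesis .
  qed
  then show ?thesis
    using perms_props(4)[OF v] perms_props(4)[OF w(2)] l g by (simp add: ecompat_pos)
qed

text \<open>Entries of \<open>c\<close> are absolute values in the pair alphabet, decoded from the
  positive representative \<open>2 * m\<close>. The outer values give \<open>q\<close> in order; the
  inner ones are sorted, because they come from a rearrangement of a compatible and hence sorted
  word.\<close>

definition fuse :: "nat \<Rightarrow> nat list \<Rightarrow> nat list \<Rightarrow> nat list set" where
  "fuse M p q = {c. map (\<lambda>m. blk (2 * m div M)) c = q \<and> sort (map (\<lambda>m. blk (bdig M (2 * m))) c) = p}"

lemma finite_fuse:
  assumes "M > 0"
  shows "finite (fuse M p q)"
proof -
  have "fuse M p q \<subseteq> {c. set c \<subseteq> {..(2 * sum_list q + 1) * M} \<and> length c = length q}"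
  proof
    fix c assume c: "c \<in> fuse M p q"
    have "m \<le> (2 * sum_list q + 1) * M" if "m \<in> set c" for m
    proof -
      define g where "g = 2 * m div M"
      have "blk g \<in> set q" using c that by (auto simp: fuse_def g_def)
      then have "blk g \<le> sum_list q" by (intro member_le_sum_list) auto
      moreover have "g \<le> 2 * blk g" by (auto simp: blk_def)
      ultimately have "g \<le> 2 * sum_list q" by linarith
      have "2 * m < (g + 1) * M"
        using assms by (simp add: g_def dividend_less_div_times)
      also have "\<dots> \<le> (2 * sum_list q + 1) * M"
        using \<open>g \<le> 2 * sum_list q\<close> by (intro mult_right_mono) auto
      finally show ?thesis by linarith
    qed
    moreover have "length c = length q" using c by (auto simp: fuse_def)
    ultimately show "c \<in> {c. set c \<subseteq> {..(2 * sum_list q + 1) * M} \<and> length c = length q}" by auto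
  qed
  then show ?thesis using finite_lists_length_eq finite_subset by blast
qed

text \<open>The code \<open>0\<close> is the pair of two letters \<open>0\<close>. Hence no word
  fused from \<open>p\<close> and \<open>q\<close> contains \<open>0\<close> as soon as one of them
  avoids it.\<close>

lemma fuse_zero:
  assumes "c \<in> fuse M p q" "0 \<in> set c"
  shows "0 \<in> set p" "0 \<in> set q"
proof -
  have p: "p = sort (map (\<lambda>m. blk (bdig M (2 * m))) c)" and q: "q = map (\<lambda>m. blk (2 * m div M)) c"
    using assms(1) by (auto simp: fuse_def)
  have z: "blk (bdig M (2 * 0)) = 0" "blk (2 * 0 div M) = 0" by (simp_all add: bdig_def)
  show "0 \<in> set p" unfolding p set_sort set_map using assms(2) z(1) by (metis imageI)
  show "0 \<in> set q" unfolding q set_map using assms(2) z(2) by (metis imageI)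
qed

text \<open>The letter \<open>0\<close> decodes to two zeros, and being the smallest it stays in
  front when the inner values are sorted.\<close>

lemma fuse_Cons_zero:
  "0 # c \<in> fuse M p q \<longleftrightarrow> (\<exists>p' q'. p = 0 # p' \<and> q = 0 # q' \<and> c \<in> fuse M p' q')"
proof -
  have "insort 0 xs = 0 # xs" for xs :: "nat list" by (cases xs) auto
  then show ?thesis by (auto simp: fuse_def bdig_def)
qed

lemma ecompat_imp_sorted:
  assumes "ecompat f w"
  shows "sorted f"
  unfolding sorted_iff_nth_Suc
proof (intro allI impI)
  fix i assume "Suc i < length f"
  then have "val f (Suc i) < val f (Suc (Suc i)) \<or> val f (Suc i) = val f (Suc (Suc i))"
    using assms unfolding ecompat_def by metis
  then show "f ! i \<le> f ! Suc i" by auto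
qed

lemma sorted_map_blk: "sorted f \<Longrightarrow> sorted (map blk f)"
  by (induction f) (auto intro: blk_mono)

text \<open>Both sides count the same objects. A factorization of \<open>w\<close> into
  \<open>u\<close> and \<open>v\<close> with enriched words \<open>f\<close> and \<open>g\<close> is
  sent to the word of codes of \<open>g\<close> over \<open>pcomp f v\<close>, which is enriched
  over \<open>w\<close>. Decoding followed by standardization inverts this.\<close>

lemma fp_product:
  assumes w: "w \<in> perms n" and M: "odd M" "\<And>x. blk x \<in> set p \<Longrightarrow> x < M"
  shows "(\<Sum>(u, v)\<in>{(u, v). u \<in> perms n \<and> v \<in> perms n \<and> pcomp u v = w}. fp p u * fp q v) =
         (\<Sum>c\<in>fuse M p q. fp c w)"
proof -
  define D where "D = {(u, v). u \<in> perms n \<and> v \<in> perms n \<and> pcomp u v = w}"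
  define S where "S = (SIGMA d:D. enriched p (fst d) \<times> enriched q (snd d))"
  define T where "T = {h. ecompat h w \<and> map blk h \<in> fuse M p q}"
  define \<Phi> where "\<Phi> = (\<lambda>((u :: nat list, v), (f, g)). map2 (bcode M) g (pcomp f v))"
  have Mpos: "M > 0" using M(1) by (auto intro: Nat.gr0I)
  have finD: "finite D" by (rule finite_subset[of _ "perms n \<times> perms n"]) (auto simp: D_def)
  \<comment> \<open>By \<open>blk_decode\<close>, the positive representatives used in
    \<open>fuse\<close> may be replaced by the actual signed letters of \<open>h\<close>.\<close>
  have blk_h: "map (\<lambda>m. blk (2 * m div M)) (map blk h) = map (\<lambda>l. blk (l div M)) h"
      "map (\<lambda>m. blk (bdig M (2 * m))) (map blk h) = map (\<lambda>l. blk (bdig M l)) h" for h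
    using blk_decode[OF M(1)] by simp_all
  have decode: "map (\<lambda>l. l div M) (map2 (bcode M) g X) = g" "map (bdig M) (map2 (bcode M) g X) = X"
    if "length g = length X" "\<And>x. x \<in> set X \<Longrightarrow> x < M" for g X
    using that by (auto simp: list_eq_iff_nth_eq bcode_div bdig_bcode)
  have S: "u \<in> perms n" "v \<in> perms n" "pcomp u v = w" "ecompat f u" "map blk f = p" "ecompat g v"
      "map blk g = q" "length f = n" "length g = n" "length v = n" "\<And>x. x \<in> set (pcomp f v) \<Longrightarrow> x < M"
    if "((u, v), (f, g)) \<in> S" for u v f g
  proof -
    show *: "u \<in> perms n" "v \<in> perms n" "pcomp u v = w" "ecompat f u" "map blk f = p" "ecompat g v"
      "map blk g = q" using that by (auto simp: S_def D_def enriched_def)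
    then show l: "length f = n" "length g = n" "length v = n"
      using perms_props(1) by (auto simp: ecompat_def)
    show "x < M" if "x \<in> set (pcomp f v)" for x
    proof (rule M(2))
      have "x \<in> set f" using that mset_eq_setD[OF mset_pcomp[OF *(2) l(1)]] by simp
      then show "blk x \<in> set p" using *(5) by auto
    qed
  qed
  have "bij_betw \<Phi> S T"
    unfolding bij_betw_def
  proof
    show "inj_on \<Phi> S"
    proof (rule inj_onI)
      fix s t assume st: "s \<in> S" "t \<in> S" "\<Phi> s = \<Phi> t"
      obtain u v f g u' v' f' g' where eq: "s = ((u, v), (f, g))" "t = ((u', v'), (f', g'))"
        by (metis prod.collapse)
      note s = S[OF st(1)[unfolded eq(1)]] and t = S[OF st(2)[unfolded eq(2)]]
      have h: "map2 (bcode M) g (pcomp f v) = map2 (bcode M) g' (pcomp f' v')"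
        using st(3) by (simp add: eq \<Phi>_def)
      have "g = g'" "pcomp f v = pcomp f' v'"
        using decode[of g "pcomp f v"] decode[of g' "pcomp f' v'"] s t h by auto
      moreover have "u = u' \<and> v = v' \<and> f = f'"
        using s t calculation by (intro standardize_unique) auto
      ultimately show "s = t" by (simp add: eq)
    qed
    show "\<Phi> ` S = T"
    proof (intro equalityI subsetI)
      fix h assume "h \<in> \<Phi> ` S"
      then obtain u v f g where s: "((u, v), (f, g)) \<in> S" and h: "h = map2 (bcode M) g (pcomp f v)"
        by (auto simp: \<Phi>_def)
      note s = S[OF s]
      have "ecompat h w" unfolding h
        using ecompat_product[OF s(1,2,4) refl s(3)[symmetric] w M(1) s(11) s(9)] s(6) by blast
      moreover have "map blk h \<in> fuse M p q"
      proof -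
        note d = decode[of g "pcomp f v", folded h]
        have "map (\<lambda>l. blk (l div M)) h = map blk (map (\<lambda>l. l div M) h)" by simp
        also have "\<dots> = q" using d(1) s by simp
        finally have 1: "map (\<lambda>l. blk (l div M)) h = q" .
        have "map (\<lambda>l. blk (bdig M l)) h = map blk (map (bdig M) h)" by simp
        also have "\<dots> = map blk (pcomp f v)" using d(2) s by simp
        finally have "mset (map (\<lambda>l. blk (bdig M l)) h) = mset p"
          using s(5) mset_pcomp[OF s(2,8)] by (metis mset_map)
        moreover have "sorted p"
          using sorted_map_blk[OF ecompat_imp_sorted[OF s(4)]] s(5) by simp
        ultimately have 2: "sort (map (\<lambda>l. blk (bdig M l)) h) = p"
          by (intro properties_for_sort) auto
        show ?thesis unfolding fuse_def mem_Collect_eq blk_h using 1 2 by blast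
      qed
      ultimately show "h \<in> T" by (simp add: T_def)
    next
      fix h assume "h \<in> T"
      then have h: "ecompat h w" "map (\<lambda>l. blk (l div M)) h = q" "sort (map (\<lambda>l. blk (bdig M l)) h) = p"
        unfolding T_def fuse_def mem_Collect_eq blk_h by blast+
      define g X where "g = map (\<lambda>l. l div M) h" and "X = map (bdig M) h"
      have len: "length h = n" using h(1) perms_props(1)[OF w] by (simp add: ecompat_def)
      have hgX: "h = map2 (bcode M) g X"
        using Mpos by (auto simp: g_def X_def list_eq_iff_nth_eq bcode_bdig)
      have XM: "x < M" if "x \<in> set X" for x
        using that Mpos by (auto simp: X_def bdig_less)
      \<comment> \<open>The inner letters of \<open>h\<close>, together with \<open>w\<close>,
        determine the factorization; the outer letters already form the word over
        \<open>v\<close>.\<close>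
      obtain u v f where uvf: "u \<in> perms n" "v \<in> perms n" "ecompat f u" "pcomp u v = w" "pcomp f v = X"
        using standardize_ex[OF w, of X] len by (auto simp: X_def)
      have "ecompat g v"
        using ecompat_product[OF uvf(1,2,3) uvf(5)[symmetric] uvf(4)[symmetric] w M(1) XM] h(1) len
        by (simp add: g_def hgX[symmetric, unfolded g_def])
      moreover have "map blk g = q" using h(2) by (simp add: g_def comp_def)
      moreover have "map blk f = p"
      proof -
        have lf: "length f = n" using uvf(3) perms_props(1)[OF uvf(1)] by (simp add: ecompat_def)
        have "sorted (map blk f)"
          using ecompat_imp_sorted[OF uvf(3)] by (rule sorted_map_blk)
        moreover have "mset (map blk f) = mset (map blk X)"
          using mset_pcomp[OF uvf(2) lf] uvf(5) by (metis mset_map)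
        moreover have "map (\<lambda>l. blk (bdig M l)) h = map blk X" by (simp add: X_def)
        ultimately show ?thesis using h(3) by (metis properties_for_sort)
      qed
      ultimately have "((u, v), (f, g)) \<in> S" using uvf by (auto simp: S_def D_def enriched_def)
      moreover have "\<Phi> ((u, v), (f, g)) = h" by (simp add: \<Phi>_def uvf hgX)
      ultimately show "h \<in> \<Phi> ` S" by force
    qed
  qed
  then have "card S = card T" by (rule bij_betw_same_card)
  moreover have "card S = (\<Sum>d\<in>D. card (enriched p (fst d)) * card (enriched q (snd d)))"
    unfolding S_def using finD by (simp add: card_cartesian_product)
  moreover have "card T = (\<Sum>c\<in>fuse M p q. card (enriched c w))"
  proof -
    have "T = (\<Union>c\<in>fuse M p q. enriched c w)" by (auto simp: T_def enriched_def)
    moreover have "card (\<Union>c\<in>fuse M p q. enriched c w) = (\<Sum>c\<in>fuse M p q. card (enriched c w))"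
      by (rule card_UN_disjoint) (use finite_fuse[OF Mpos] in simp, simp, auto simp: enriched_def)
    ultimately show ?thesis by simp
  qed
  ultimately have "(\<Sum>d\<in>D. card (enriched p (fst d)) * card (enriched q (snd d))) =
     (\<Sum>c\<in>fuse M p q. card (enriched c w))" by simp
  then have "of_nat (\<Sum>d\<in>D. card (enriched p (fst d)) * card (enriched q (snd d))) =
     (of_nat (\<Sum>c\<in>fuse M p q. card (enriched c w)) :: rat)" by simp
  then show ?thesis
    by (simp add: fp_def D_def split_beta)
qed


section \<open>Removing two letters\<close>

definition lift12 :: "nat list \<Rightarrow> nat list" where
  "lift12 w = 1 # 2 # map (\<lambda>a. a + 2) w"

definition lift21 :: "nat list \<Rightarrow> nat list" where
  "lift21 w = 2 # 1 # map (\<lambda>a. a + 2) w"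

lemma lift_perms:
  assumes "w \<in> perms m"
  shows "lift12 w \<in> perms (m + 2)" "lift21 w \<in> perms (m + 2)"
proof -
  have "(\<lambda>a. a + 2) ` {1..m} = {1 + 2..m + 2}" by (rule image_add_atLeastAtMost')
  moreover have "{1..m + 2} = insert 1 (insert 2 {1 + 2..m + 2})" by auto
  moreover have "distinct (map (\<lambda>a. a + 2) w)"
    using perms_props(2)[OF assms] by (simp add: distinct_map inj_on_def)
  ultimately show "lift12 w \<in> perms (m + 2)" "lift21 w \<in> perms (m + 2)"
    using perms_props(3)[OF assms]
    by (simp_all only: perms_def lift12_def lift21_def mem_Collect_eq list.set set_map distinct.simps) auto
qed

text \<open>The raised letters all exceed \<open>2\<close>, so position \<open>2\<close> is never a
  peak and later positions compare as in \<open>w\<close>. Only position \<open>1\<close>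
  distinguishes the two prefixes.\<close>

lemma Peak_lift:
  assumes w: "w \<in> perms m"
  shows "Peak (m + 2) (lift12 w) = (\<lambda>i. i + 2) ` Peak m w"
    and "Peak (m + 2) (lift21 w) = insert 1 ((\<lambda>i. i + 2) ` Peak m w)"
proof -
  note l = perms_props(1)[OF w]
  have pos: "0 < w ! i" if "i < m" for i using perms_nth[OF w that] by simp
  have 3: "i + 2 \<in> Peak (m + 2) u \<longleftrightarrow> i \<in> Peak m w"
    if "u = lift12 w \<or> u = lift21 w" "1 \<le> i" for i u
  proof (cases i)
    case (Suc j)
    show ?thesis
    proof (cases "i < m")
      case True
      have V: "val u (k + 2) = val w k + 2" if "1 \<le> k" "k \<le> m" for k
        using that \<open>u = lift12 w \<or> u = lift21 w\<close> l
        by (cases k) (auto simp: lift12_def lift21_def val_def)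
      have "val u (j + 2) < val u (i + 2) \<longleftrightarrow> val w j < val w i"
      proof (cases j)
        case 0
        \<comment> \<open>Here the first letter of \<open>w\<close> has the \<open>0\<close> in
          front of it on one side and a prefix letter on the other; it exceeds both.\<close>
        have "val u 2 \<le> 2" using that(1) by (auto simp: lift12_def lift21_def val_def)
        then show ?thesis using V[of i] True Suc 0 pos[of 0] by (simp add: numeral_2_eq_2)
      next
        case (Suc k)
        then show ?thesis using V[of j] V[of i] True \<open>i = Suc j\<close> by simp
      qed
      moreover have "val u (i + 2 - 1) = val u (j + 2)" "val w (i - 1) = val w j" using Suc by simp_all
      moreover have "val u (i + 2 + 1) < val u (i + 2) \<longleftrightarrow> val w (i + 1) < val w i"
        using V[of i] V[of "i + 1"] True that(2) by simp
      ultimately show ?thesis using True that(2) unfolding Peak_def mem_Collect_eq by auto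
    qed (auto simp: Peak_def)
  qed (use that in simp)
  have 3: "i \<in> Peak (m + 2) u \<longleftrightarrow> i - 2 \<in> Peak m w"
    if "u = lift12 w \<or> u = lift21 w" "3 \<le> i" for i u
  proof -
    have "i - 2 + 2 = i" using that(2) by simp
    then show ?thesis using 3[OF that(1), of "i - 2"] that(2) by (simp del: add_2_eq_Suc')
  qed
  have 0: "0 \<notin> Peak m w" "0 \<notin> Peak n u" for n u by (auto simp: Peak_def)
  have 1: "1 \<notin> Peak (m + 2) (lift12 w)" "1 \<in> Peak (m + 2) (lift21 w)"
    by (auto simp: Peak_def lift12_def lift21_def)
  have 2: "2 \<notin> Peak (m + 2) u" if "u = lift12 w \<or> u = lift21 w" for u
    using that l by (cases w) (auto simp: Peak_def lift12_def lift21_def numeral_2_eq_2)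
  have im: "i \<in> (\<lambda>i. i + 2) ` Peak m w \<longleftrightarrow> i \<ge> 3 \<and> i - 2 \<in> Peak m w" for i
  proof
    assume "i \<in> (\<lambda>i. i + 2) ` Peak m w"
    then show "i \<ge> 3 \<and> i - 2 \<in> Peak m w" by (auto simp: Peak_def)
  next
    assume "i \<ge> 3 \<and> i - 2 \<in> Peak m w"
    then show "i \<in> (\<lambda>i. i + 2) ` Peak m w" by (intro image_eqI[of _ _ "i - 2"]) auto
  qed
  have "i \<in> Peak (m + 2) (lift12 w) \<longleftrightarrow> i \<in> (\<lambda>i. i + 2) ` Peak m w" for i
  proof -
    consider "i = 0" | "i = 1" | "i = 2" | "i \<ge> 3" by linarith
    then show ?thesis unfolding im
      using 0 1 2 3[of "lift12 w" i] by cases auto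
  qed
  then show "Peak (m + 2) (lift12 w) = (\<lambda>i. i + 2) ` Peak m w" by blast
  have "i \<in> Peak (m + 2) (lift21 w) \<longleftrightarrow> i \<in> insert 1 ((\<lambda>i. i + 2) ` Peak m w)" for i
  proof -
    consider "i = 0" | "i = 1" | "i = 2" | "i \<ge> 3" by linarith
    then show ?thesis unfolding im insert_iff
      using 0 1 2 3[of "lift21 w" i] by cases auto
  qed
  then show "Peak (m + 2) (lift21 w) = insert 1 ((\<lambda>i. i + 2) ` Peak m w)" by blast
qed

definition fp_red :: "nat list \<Rightarrow> nat list \<Rightarrow> rat" where
  "fp_red p w = (if take 2 p = [0, 0] then fp (drop 2 p) w else 0)"

text \<open>The two peak sets differ only in the peak at \<open>1\<close>, which is forbidden
  exactly when \<open>p\<close> starts with two zeros. Otherwise the counts cancel; in that case the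
  second count vanishes and the first is the count of the shortened word.\<close>

lemma fp_lift:
  assumes w: "w \<in> perms m"
  shows "fp p (lift12 w) - fp p (lift21 w) = fp_red p w"
proof (cases "length p = m + 2")
  case False
  then have "length (drop 2 p) \<noteq> m \<or> take 2 p \<noteq> [0, 0]" 
    by (auto dest: arg_cong[where f = length])
  then show ?thesis using False
    by (auto simp: fp_eq[OF lift_perms(1)[OF w]] fp_eq[OF lift_perms(2)[OF w]] fp_eq[OF w] fp_red_def)
next
  case True
  then obtain a b p' where p: "p = a # b # p'" "length p' = m"
    by (auto simp: length_Suc_conv)
  define Q where "Q i \<longleftrightarrow> \<not> (val p (i - 1) = val p i \<and> val p i = val p (Suc i))" for i
  define A where "A \<longleftrightarrow> (\<forall>i<m + 2. val p i \<le> val p (Suc i))"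
  have 12: "fp p (lift12 w) = (if A \<and> (\<forall>i\<in>Peak m w. Q (i + 2)) then 2 ^ card (set p - {0}) else 0)"
    unfolding fp_eq[OF lift_perms(1)[OF w]] Peak_lift[OF w] ball_simps(9) using True
    by (auto simp: Q_def A_def)
  have 21: "fp p (lift21 w) = (if A \<and> Q 1 \<and> (\<forall>i\<in>Peak m w. Q (i + 2)) then 2 ^ card (set p - {0}) else 0)"
    unfolding fp_eq[OF lift_perms(2)[OF w]] Peak_lift[OF w] ball_simps(7,9) using True
    by (auto simp: Q_def A_def)
  have Q1: "Q 1 \<longleftrightarrow> \<not> (a = 0 \<and> b = 0)" by (auto simp: Q_def p)
  show ?thesis
  proof (cases "a = 0 \<and> b = 0")
    case True
    \<comment> \<open>At \<open>i = 0\<close> the second removed zero plays the part of the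
      \<open>0\<close> in front of \<open>p'\<close>.\<close>
    have v: "val p (i + 2) = val p' i" for i
      using True by (cases i) (auto simp: p val_def)
    have "A \<longleftrightarrow> (\<forall>i<m. val p' i \<le> val p' (Suc i))"
    proof
      assume A
      show "\<forall>i<m. val p' i \<le> val p' (Suc i)"
      proof (intro allI impI)
        fix i assume "i < m"
        then have "val p (i + 2) \<le> val p (Suc i + 2)"
          using \<open>A\<close>[unfolded A_def, rule_format, of "i + 2"] by (simp del: val_Suc)
        then show "val p' i \<le> val p' (Suc i)" unfolding v .
      qed
    next
      assume *: "\<forall>i<m. val p' i \<le> val p' (Suc i)"
      show A unfolding A_def
      proof (intro allI impI)
        fix i assume "i < m + 2"
        show "val p i \<le> val p (Suc i)"
        proof (cases "i \<ge> 2")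
          case True
          then obtain k where k: "i = k + 2" by (metis add.commute le_Suc_ex)
          then have "val p (k + 2) \<le> val p (Suc k + 2)"
            unfolding v using * \<open>i < m + 2\<close> by simp
          then show ?thesis using k by (simp del: val_Suc)
        next
          case False
          then have "i = 0 \<or> i = 1" by auto
          then show ?thesis using True by (auto simp: p)
        qed
      qed
    qed
    moreover have "(\<forall>i\<in>Peak m w. Q (i + 2)) \<longleftrightarrow>
      (\<forall>i\<in>Peak m w. \<not> (val p' (i - 1) = val p' i \<and> val p' i = val p' (Suc i)))"
    proof (rule ball_cong[OF refl])
      fix i assume "i \<in> Peak m w"
      then have "i + 2 - 1 = (i - 1) + 2" by (auto simp: Peak_def)
      then show "Q (i + 2) \<longleftrightarrow> \<not> (val p' (i - 1) = val p' i \<and> val p' i = val p' (Suc i))"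
        unfolding Q_def using v[of i] v[of "i - 1"] v[of "Suc i"] by (simp del: val_Suc)
    qed
    moreover have "set p - {0} = set p' - {0}" using True by (auto simp: p)
    ultimately show ?thesis
      using True p(2) unfolding 12 21 Q1 by (simp add: fp_red_def fp_eq[OF w] p)
  next
    case False
    then show ?thesis unfolding 12 21 Q1 by (auto simp: fp_red_def p)
  qed
qed

text \<open>The words \<open>c\<close> that survive the reduction start with two zeros. By
  \<open>fuse_Cons_zero\<close>, applied twice, they arise only when \<open>p\<close> and
  \<open>q\<close> both do, and what remains is the product formula for the shortened words.\<close>

lemma fp_red_product:
  assumes w: "w \<in> perms m" and M: "odd M" "\<And>x. blk x \<in> set p \<Longrightarrow> x < M"
  shows "(\<Sum>(u, v)\<in>{(u, v). u \<in> perms m \<and> v \<in> perms m \<and> pcomp u v = w}. fp_red p u * fp_red q v) =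
         (\<Sum>c\<in>fuse M p q. fp_red c w)"
proof -
  have Mpos: "M > 0" using M(1) by (auto intro: Nat.gr0I)
  have red: "take 2 c = [0, 0] \<longleftrightarrow> (\<exists>c'. c = 0 # 0 # c')" for c :: "nat list"
    by (cases c; cases "tl c") auto
  have "(\<Sum>c\<in>fuse M p q. fp_red c w) = (\<Sum>c\<in>{c \<in> fuse M p q. take 2 c = [0, 0]}. fp (drop 2 c) w)"
    using finite_fuse[OF Mpos] by (simp add: fp_red_def sum.inter_filter)
  also have "{c \<in> fuse M p q. take 2 c = [0, 0]} = (\<lambda>c. 0 # 0 # c) ` {c. 0 # 0 # c \<in> fuse M p q}"
    by (auto simp: red)
  also have "(\<Sum>c\<in>(\<lambda>c. 0 # 0 # c) ` {c. 0 # 0 # c \<in> fuse M p q}. fp (drop 2 c) w) =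
      (\<Sum>c\<in>{c. 0 # 0 # c \<in> fuse M p q}. fp c w)"
    by (subst sum.reindex) (auto simp: inj_on_def)
  finally have rhs: "(\<Sum>c\<in>fuse M p q. fp_red c w) = (\<Sum>c\<in>{c. 0 # 0 # c \<in> fuse M p q}. fp c w)" .
  show ?thesis
  proof (cases "take 2 p = [0, 0] \<and> take 2 q = [0, 0]")
    case True
    then obtain p' q' where pq: "p = 0 # 0 # p'" "q = 0 # 0 # q'" by (auto simp: red)
    have "{c. 0 # 0 # c \<in> fuse M p q} = fuse M p' q'" by (auto simp: fuse_Cons_zero pq)
    moreover have "(\<Sum>(u, v)\<in>{(u, v). u \<in> perms m \<and> v \<in> perms m \<and> pcomp u v = w}. fp p' u * fp q' v) =
         (\<Sum>c\<in>fuse M p' q'. fp c w)"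
      using M by (intro fp_product w) (auto simp: pq)
    ultimately show ?thesis unfolding rhs by (simp add: fp_red_def pq)
  next
    case False
    then have "{c. 0 # 0 # c \<in> fuse M p q} = {}" by (auto simp: fuse_Cons_zero)
    moreover have "(\<Sum>(u, v)\<in>{(u, v). u \<in> perms m \<and> v \<in> perms m \<and> pcomp u v = w}. fp_red p u * fp_red q v) = 0"
      by (rule sum.neutral) (use False in \<open>auto simp: fp_red_def\<close>)
    ultimately show ?thesis unfolding rhs by simp
  qed
qed

text \<open>The involution exchanging \<open>i\<close> and \<open>i + 1\<close> for every
  \<open>i\<close> in \<open>F\<close> is well defined because \<open>F\<close> has no consecutive
  elements, and its peaks are exactly the elements of \<open>F\<close>.\<close>

lemma Peak_surj:
  assumes F: "F \<in> Fam m"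
  shows "\<exists>w\<in>perms m. Peak m w = F"
proof -
  define s where "s i = (if i \<in> F then i + 1 else if i - 1 \<in> F then i - 1 else i)" for i
  define w where "w = map s [1..<Suc m]"
  have sub: "i \<in> F \<Longrightarrow> 1 \<le> i \<and> i < m \<and> Suc i \<notin> F" for i
    using F by (fastforce simp: Fam_def)
  have inv: "s (s i) = i" if "1 \<le> i" for i
    using that sub[of i] sub[of "i - 1"] by (auto simp: s_def)
  have rng: "s i \<in> {1..m}" if "i \<in> {1..m}" for i
    using that sub[of i] sub[of "i - 1"] by (auto simp: s_def)
  have "inj_on s {1..m}" using inv by (metis inj_onI atLeastAtMost_iff)
  moreover have "s ` {1..m} = {1..m}"
  proof
    show "{1..m} \<subseteq> s ` {1..m}"
    proof
      fix i assume "i \<in> {1..m}"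
      then have "i = s (s i)" "s i \<in> {1..m}" using inv[of i] rng[of i] by auto
      then show "i \<in> s ` {1..m}" by (rule image_eqI)
    qed
  qed (use rng in auto)
  moreover have "set [1..<Suc m] = {1..m}" by auto
  ultimately have w: "w \<in> perms m"
    unfolding perms_def w_def by (simp add: distinct_map del: upt_Suc)
  have v: "val w i = s i" if "1 \<le> i" "i \<le> m" for i
    using that by (simp add: val_def w_def del: upt_Suc)
  have v': "val w (i - 1) \<le> i - 1 \<or> i - 1 \<in> F" if "1 \<le> i" "i \<le> m" for i
  proof (cases "i = 1")
    case False
    then show ?thesis using that by (subst v) (auto simp: s_def)
  qed simp
  have "i \<in> Peak m w \<longleftrightarrow> i \<in> F" for i
  proof (cases "i \<in> F")
    case True
    have i: "1 \<le> i" "i < m" "Suc i \<notin> F" "i - 1 \<notin> F" using sub[OF True] sub[of "i - 1"] True by auto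
    then show ?thesis using v[of i] v[of "Suc i"] v'[of i] True by (auto simp: Peak_def s_def simp del: val_Suc)
  next
    case False
    have "\<not> (val w (i - 1) < val w i \<and> val w (Suc i) < val w i)" if i: "1 \<le> i" "i < m"
    proof (cases "i - 1 \<in> F")
      case True
      then have "val w (i - 1) = i" "val w i = i - 1"
        using v[of "i - 1"] v[of i] sub[OF True] i False by (auto simp: s_def simp del: val_Suc)
      then show ?thesis by simp
    next
      case f: False
      then have "val w i = i" "val w (Suc i) \<ge> Suc i"
        using v[of i] v[of "Suc i"] i False by (auto simp: s_def simp del: val_Suc)
      then show ?thesis by simp
    qed
    then show ?thesis using False by (auto simp: Peak_def simp del: val_Suc)
  qed
  then show ?thesis using w by blast
qed

section \<open>The ideal and the quotient\<close>

text \<open>The families \<open>a\<close> and \<open>b\<close> are kept arbitrary so that this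
  serves both \<open>fp\<close> and \<open>fp_red\<close>.\<close>

lemma ga_mult_bilinear:
  assumes w: "w \<in> perms n"
    and x: "\<And>u. u \<in> perms n \<Longrightarrow> x u = (\<Sum>p\<in>P. \<alpha> p * a p u)"
    and y: "\<And>u. u \<in> perms n \<Longrightarrow> y u = (\<Sum>q\<in>Q. \<beta> q * b q u)"
  shows "ga_mult n x y w = (\<Sum>p\<in>P. \<Sum>q\<in>Q. \<alpha> p * \<beta> q *
    (\<Sum>(u, v)\<in>{(u, v). u \<in> perms n \<and> v \<in> perms n \<and> pcomp u v = w}. a p u * b q v))"
proof -
  define D where "D = {(u, v). u \<in> perms n \<and> v \<in> perms n \<and> pcomp u v = w}"
  have "ga_mult n x y w = (\<Sum>d\<in>D. (\<Sum>p\<in>P. \<alpha> p * a p (fst d)) * (\<Sum>q\<in>Q. \<beta> q * b q (snd d)))"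
    using w unfolding ga_mult_def D_def[symmetric] by (auto simp: D_def x y intro!: sum.cong)
  also have "\<dots> = (\<Sum>d\<in>D. \<Sum>p\<in>P. \<Sum>q\<in>Q. \<alpha> p * \<beta> q * (a p (fst d) * b q (snd d)))"
    by (simp add: sum_product mult_ac)
  also have "\<dots> = (\<Sum>p\<in>P. \<Sum>d\<in>D. \<Sum>q\<in>Q. \<alpha> p * \<beta> q * (a p (fst d) * b q (snd d)))"
    by (rule sum.swap)
  also have "\<dots> = (\<Sum>p\<in>P. \<Sum>q\<in>Q. \<Sum>d\<in>D. \<alpha> p * \<beta> q * (a p (fst d) * b q (snd d)))"
    by (intro sum.cong refl sum.swap)
  finally show ?thesis by (simp add: sum_distrib_left D_def split_beta)
qed

text \<open>The letters with absolute value at most \<open>n\<close> are \<open>0\<close> to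
  \<open>2 * n\<close>, an alphabet of odd size as the pair codes require.\<close>

lemma fpwords_bound:
  assumes "p \<in> fpwords n" "blk x \<in> set p"
  shows "x < 2 * n + 1"
proof -
  have "blk x \<le> n" using assms by (auto simp: fpwords_def)
  then show ?thesis by (auto simp: blk_def)
qed

lemma ga_mult_fp:
  assumes "w \<in> perms n" "P \<subseteq> fpwords n" "Q \<subseteq> fpwords n"
    and "\<And>u. u \<in> perms n \<Longrightarrow> x u = (\<Sum>p\<in>P. \<alpha> p * fp p u)"
    and "\<And>u. u \<in> perms n \<Longrightarrow> y u = (\<Sum>q\<in>Q. \<beta> q * fp q u)"
  shows "ga_mult n x y w = (\<Sum>p\<in>P. \<Sum>q\<in>Q. \<alpha> p * \<beta> q * (\<Sum>c\<in>fuse (2 * n + 1) p q. fp c w))"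
proof -
  have "(\<Sum>(u, v)\<in>{(u, v). u \<in> perms n \<and> v \<in> perms n \<and> pcomp u v = w}. fp p u * fp q v) =
      (\<Sum>c\<in>fuse (2 * n + 1) p q. fp c w)" if "p \<in> P" for p q
    using fpwords_bound that assms(2) by (intro fp_product assms(1)) auto
  then show ?thesis
    by (subst ga_mult_bilinear[OF assms(1,4,5)]) simp_all
qed

lemma ga_mult_in_ga: "ga_mult n x y \<in> ga n"
  by (simp add: ga_def ga_mult_def)

text \<open>By \<open>fuse_zero\<close> every word in the expansion of the product avoids
  \<open>0\<close>, so its counting function sees only interior peaks. Placing the condition on
  either factor treats left and right multiplication at once.\<close>

lemma ga_mult_ideal:
  assumes "x \<in> fp_span P n" "y \<in> fp_span Q n" "P \<subseteq> fpwords n" "Q \<subseteq> fpwords n"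
    and z: "\<And>p q. p \<in> P \<Longrightarrow> q \<in> Q \<Longrightarrow> 0 \<notin> set p \<or> 0 \<notin> set q"
  shows "ga_mult n x y \<in> peak_ideal n"
  unfolding peak_ideal_iff
proof (intro conjI ballI impI ga_mult_in_ga)
  obtain \<alpha> \<beta> where
    x: "\<And>u. u \<in> perms n \<Longrightarrow> x u = (\<Sum>p\<in>P. \<alpha> p * fp p u)" and
    y: "\<And>u. u \<in> perms n \<Longrightarrow> y u = (\<Sum>q\<in>Q. \<beta> q * fp q u)"
    using assms(1,2) unfolding fp_span_def by blast
  have prod: "ga_mult n x y u = (\<Sum>p\<in>P. \<Sum>q\<in>Q. \<alpha> p * \<beta> q * (\<Sum>c\<in>fuse (2 * n + 1) p q. fp c u))"
    if "u \<in> perms n" for u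
    by (rule ga_mult_fp[OF that assms(3,4) x y])
  fix w w' assume w: "w \<in> perms n" "w' \<in> perms n" "IPeak n w = IPeak n w'"
  show "ga_mult n x y w = ga_mult n x y w'"
    unfolding prod[OF w(1)] prod[OF w(2)]
  proof (intro sum.cong refl arg_cong2[where f = "(*)"])
    fix p q c assume *: "p \<in> P" "q \<in> Q" "c \<in> fuse (2 * n + 1) p q"
    then have "0 \<notin> set c" using z fuse_zero by blast
    then show "fp c w = fp c w'" by (rule fp_IPeak_cong[OF w])
  qed
qed

lemma peak_ideal_subset: "peak_ideal n \<subseteq> peak_alg n"
proof
  fix x assume "x \<in> peak_ideal n"
  then show "x \<in> peak_alg n" unfolding peak_ideal_iff peak_alg_iff IPeak_eq by metis
qed

lemma peak_ideal_two_sided: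
  assumes "x \<in> peak_ideal n" "y \<in> peak_alg n"
  shows "ga_mult n x y \<in> peak_ideal n" "ga_mult n y x \<in> peak_ideal n"
proof -
  note spans = peak_ideal_span[OF assms(1)] peak_alg_span[OF assms(2)]
  show "ga_mult n x y \<in> peak_ideal n"
    by (rule ga_mult_ideal[OF spans]) auto
  show "ga_mult n y x \<in> peak_ideal n"
    by (rule ga_mult_ideal[OF spans(2,1)]) auto
qed

section \<open>The reduction map: multiplicativity, image and kernel\<close>

definition peak_red :: "nat \<Rightarrow> (nat list \<Rightarrow> rat) \<Rightarrow> nat list \<Rightarrow> rat" where
  "peak_red m x = (\<lambda>w. if w \<in> perms m then x (lift12 w) - x (lift21 w) else 0)"

text \<open>On \<open>fp p\<close> the map acts as \<open>fp_red p\<close>, and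
  \<open>fp_red\<close> multiplies with the same sets \<open>fuse M p q\<close> as
  \<open>fp\<close>. Expanding both factors in counting functions therefore suffices.\<close>

lemma peak_red_mult:
  assumes x: "x \<in> peak_alg (m + 2)" and y: "y \<in> peak_alg (m + 2)"
  shows "peak_red m (ga_mult (m + 2) x y) = ga_mult m (peak_red m x) (peak_red m y)"
proof
  fix w
  define P where "P = fpwords (m + 2)"
  define M where "M = 2 * (m + 2) + 1"
  obtain \<alpha> \<beta> where
    x: "\<And>u. u \<in> perms (m + 2) \<Longrightarrow> x u = (\<Sum>p\<in>P. \<alpha> p * fp p u)" and
    y: "\<And>u. u \<in> perms (m + 2) \<Longrightarrow> y u = (\<Sum>q\<in>P. \<beta> q * fp q u)"
    using peak_alg_span[OF x] peak_alg_span[OF y] unfolding fp_span_def P_def by blast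
  have red: "peak_red m z u = (\<Sum>p\<in>P. \<gamma> p * fp_red p u)"
    if "u \<in> perms m" "\<And>u. u \<in> perms (m + 2) \<Longrightarrow> z u = (\<Sum>p\<in>P. \<gamma> p * fp p u)" for z \<gamma> u
    using lift_perms[OF that(1)] that
    by (simp add: peak_red_def fp_lift[symmetric] right_diff_distrib sum_subtractf)
  show "peak_red m (ga_mult (m + 2) x y) w = ga_mult m (peak_red m x) (peak_red m y) w"
  proof (cases "w \<in> perms m")
    case True
    have prod: "ga_mult (m + 2) x y u = (\<Sum>p\<in>P. \<Sum>q\<in>P. \<alpha> p * \<beta> q * (\<Sum>c\<in>fuse M p q. fp c u))"
      if "u \<in> perms (m + 2)" for u
      unfolding M_def by (rule ga_mult_fp[OF that _ _ x y]) (simp_all add: P_def)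
    have "peak_red m (ga_mult (m + 2) x y) w =
        (\<Sum>p\<in>P. \<Sum>q\<in>P. \<alpha> p * \<beta> q * (\<Sum>c\<in>fuse M p q. fp_red c w))"
      using True lift_perms[OF True]
      by (simp add: peak_red_def prod fp_lift[symmetric] right_diff_distrib sum_subtractf del: add_2_eq_Suc')
    also have "\<dots> = (\<Sum>p\<in>P. \<Sum>q\<in>P. \<alpha> p * \<beta> q *
      (\<Sum>(u, v)\<in>{(u, v). u \<in> perms m \<and> v \<in> perms m \<and> pcomp u v = w}. fp_red p u * fp_red q v))"
    proof (intro sum.cong refl arg_cong2[where f = "(*)"] fp_red_product[symmetric] True)
      show "odd M" by (simp add: M_def)
      show "a < M" if "p \<in> P" "blk a \<in> set p" for p a
        using fpwords_bound[of p "m + 2" a] that by (simp add: P_def M_def)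
    qed
    also have "\<dots> = ga_mult m (peak_red m x) (peak_red m y) w"
      by (intro ga_mult_bilinear[symmetric] True red x y)
    finally show ?thesis .
  qed (simp add: peak_red_def ga_mult_def)
qed

text \<open>The image consists of functions of the peak set by \<open>Peak_lift\<close>. Conversely,
  a preimage of \<open>y\<close> can be supported on permutations without a peak at
  \<open>1\<close>, so that its values at \<open>lift21 w\<close> vanish.\<close>

lemma peak_red_image: "peak_red m ` peak_alg (m + 2) = peak_alg m"
proof (intro equalityI subsetI)
  fix z assume "z \<in> peak_red m ` peak_alg (m + 2)"
  then obtain x where x: "x \<in> peak_alg (m + 2)" and z: "z = peak_red m x" by auto
  show "z \<in> peak_alg m" unfolding peak_alg_iff
  proof (intro conjI ballI impI)
    fix w w' assume w: "w \<in> perms m" "w' \<in> perms m" "Peak m w = Peak m w'"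
    have "x (lift12 w) = x (lift12 w')" "x (lift21 w) = x (lift21 w')"
      using x lift_perms[OF w(1)] lift_perms[OF w(2)] Peak_lift[OF w(1)] Peak_lift[OF w(2)] w(3)
      unfolding peak_alg_iff by metis+
    then show "z w = z w'" using w by (simp add: z peak_red_def)
  qed (simp add: z ga_def peak_red_def)
next
  fix y assume y: "y \<in> peak_alg m"
  \<comment> \<open>The shift of peak sets by two is undone here. Where no \<open>v\<close> exists
    the value is arbitrary, but it still depends on \<open>F\<close> only.\<close>
  define d where "d F = y (SOME v. v \<in> perms m \<and> Peak m v = {i. i + 2 \<in> F})" for F
  define x where "x u = (if u \<in> perms (m + 2) \<and> 1 \<notin> Peak (m + 2) u then d (Peak (m + 2) u) else 0)" for u
  have "x \<in> peak_alg (m + 2)" by (simp add: peak_alg_iff ga_def x_def)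
  moreover have "peak_red m x = y"
  proof
    fix w
    show "peak_red m x w = y w"
    proof (cases "w \<in> perms m")
      case True
      let ?v = "SOME v. v \<in> perms m \<and> Peak m v = Peak m w"
      have "?v \<in> perms m \<and> Peak m ?v = Peak m w" by (rule someI[of _ w]) (use True in simp)
      then have "y ?v = y w" using y True unfolding peak_alg_iff by blast
      moreover have "{i. i + 2 \<in> (\<lambda>i. i + 2) ` Peak m w} = Peak m w" by auto
      moreover have "1 \<notin> (\<lambda>i. i + 2) ` Peak m w" by auto
      ultimately show ?thesis
        using True lift_perms[OF True] by (simp add: peak_red_def x_def d_def Peak_lift[OF True] del: One_nat_def add_2_eq_Suc')
    next
      case False
      then show ?thesis using y by (simp add: peak_red_def peak_alg_iff ga_def)
    qed
  qed
  ultimately show "y \<in> peak_red m ` peak_alg (m + 2)" by blast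
qed

text \<open>Permutations with equal interior peak sets have peak sets that agree or differ in
  \<open>1\<close> alone. Each such pair of sets is attained by \<open>lift12 v\<close> and
  \<open>lift21 v\<close> for some \<open>v\<close>, so vanishing of the reduction says that
  \<open>x\<close> ignores a peak at \<open>1\<close>.\<close>

lemma peak_red_kernel:
  assumes x: "x \<in> peak_alg (m + 2)"
  shows "peak_red m x = (\<lambda>w. 0) \<longleftrightarrow> x \<in> peak_ideal (m + 2)"
proof
  assume "x \<in> peak_ideal (m + 2)"
  then have cong: "x w = x w'" if "w \<in> perms (m + 2)" "w' \<in> perms (m + 2)"
      "IPeak (m + 2) w = IPeak (m + 2) w'" for w w'
    using that unfolding peak_ideal_iff by blast
  have "x (lift12 w) = x (lift21 w)" if "w \<in> perms m" for w
    by (intro cong lift_perms that) (simp add: IPeak_eq Peak_lift[OF that] del: add_2_eq_Suc')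
  then show "peak_red m x = (\<lambda>w. 0)" by (auto simp: peak_red_def)
next
  assume z: "peak_red m x = (\<lambda>w. 0)"
  have cong: "x w = x w'" if "w \<in> perms (m + 2)" "w' \<in> perms (m + 2)" "Peak (m + 2) w = Peak (m + 2) w'" for w w'
    using that x unfolding peak_alg_iff by blast
  have insert: "x w = x w'"
    if w: "w \<in> perms (m + 2)" "w' \<in> perms (m + 2)" "1 \<notin> Peak (m + 2) w"
      "Peak (m + 2) w' = insert 1 (Peak (m + 2) w)" for w w'
  proof -
    define F where "F = {i. i + 2 \<in> Peak (m + 2) w}"
    have fam: "Peak (m + 2) w \<in> Fam (m + 2)" "insert 1 (Peak (m + 2) w) \<in> Fam (m + 2)"
      using Peak_in_Fam[of "m + 2" w] Peak_in_Fam[of "m + 2" w'] unfolding w(4) by blast+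
    \<comment> \<open>Because adding \<open>1\<close> still gives a peak set, \<open>2\<close> is
      excluded; so all peaks of \<open>w\<close> are at least \<open>3\<close> and can be shifted
      down by two to a member of \<open>Fam m\<close>.\<close>
    have "1 + 1 \<notin> insert 1 (Peak (m + 2) w)"
      using fam(2) unfolding Fam_def by blast
    then have "2 \<notin> Peak (m + 2) w" by (simp add: numeral_2_eq_2)
    moreover have "0 \<notin> Peak (m + 2) w" using fam(1) by (auto simp: Fam_def)
    ultimately have ge: "i \<ge> 3" if "i \<in> Peak (m + 2) w" for i
      using w(3) that by (cases "i = 0 \<or> i = 1 \<or> i = 2") auto
    have F: "(\<lambda>i. i + 2) ` F = Peak (m + 2) w"
    proof (intro equalityI subsetI)
      fix i assume i: "i \<in> Peak (m + 2) w"
      have "i = i - 2 + 2" using ge[OF i] by simp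
      moreover have "i - 2 \<in> F" unfolding F_def mem_Collect_eq using i calculation by metis
      ultimately show "i \<in> (\<lambda>i. i + 2) ` F" by (rule image_eqI)
    qed (auto simp: F_def)
    have "F \<in> Fam m"
    proof -
      have "i \<in> {1..m-1} \<and> i + 1 \<notin> F" if "i \<in> F" for i
      proof -
        have "i + 2 \<in> Peak (m + 2) w" using that by (simp add: F_def)
        then have "3 \<le> i + 2" "i + 2 \<le> m + 2 - 1" "i + 2 + 1 \<notin> Peak (m + 2) w"
          using fam(1) ge[of "i + 2"] by (auto simp: Fam_def)
        then show ?thesis by (auto simp: F_def)
      qed
      then show ?thesis by (auto simp: Fam_def)
    qed
    then obtain v where v: "v \<in> perms m" "Peak m v = F" using Peak_surj by blast
    have "x w = x (lift12 v)"
      using lift_perms[OF v(1)] Peak_lift[OF v(1)] F v by (intro cong w) simp_all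
    also have "\<dots> = x (lift21 v)"
      using fun_cong[OF z, of v] v by (simp add: peak_red_def)
    also have "\<dots> = x w'"
      using lift_perms[OF v(1)] Peak_lift[OF v(1)] F v w(4) by (intro cong w) simp_all
    finally show ?thesis .
  qed
  show "x \<in> peak_ideal (m + 2)" unfolding peak_ideal_iff
  proof (intro conjI ballI impI)
    show "x \<in> ga (m + 2)" using x by (simp add: peak_alg_iff)
    fix w w' assume w: "w \<in> perms (m + 2)" "w' \<in> perms (m + 2)" "IPeak (m + 2) w = IPeak (m + 2) w'"
    then have "Peak (m + 2) w = Peak (m + 2) w' \<or>
        1 \<notin> Peak (m + 2) w \<and> Peak (m + 2) w' = insert 1 (Peak (m + 2) w) \<or>
        1 \<notin> Peak (m + 2) w' \<and> Peak (m + 2) w = insert 1 (Peak (m + 2) w')"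
      unfolding IPeak_eq by blast
    then show "x w = x w'" using cong insert w(1,2) by metis
  qed
qed

text \<open>The isomorphism with the quotient is expressed by a linear, multiplicative map onto
  \<open>peak_alg (n - 2)\<close> whose kernel on \<open>peak_alg n\<close> is the peak ideal; the
  map is \<open>peak_red (n - 2)\<close>.\<close>

theorem theorem5p7:
  shows "peak_ideal n \<subseteq> peak_alg n
     \<and> (\<forall>x\<in>peak_ideal n. \<forall>y\<in>peak_alg n.
          ga_mult n x y \<in> peak_ideal n \<and> ga_mult n y x \<in> peak_ideal n)
     \<and> (2 \<le> n \<longrightarrow>
          (\<exists>\<phi> :: (nat list \<Rightarrow> rat) \<Rightarrow> (nat list \<Rightarrow> rat).
             \<phi> ` peak_alg n = peak_alg (n - 2)
           \<and> (\<forall>x\<in>peak_alg n. \<forall>y\<in>peak_alg n. \<phi> (\<lambda>w. x w + y w) = (\<lambda>w. \<phi> x w + \<phi> y w))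
           \<and> (\<forall>x\<in>peak_alg n. \<forall>c::rat. \<phi> (\<lambda>w. c * x w) = (\<lambda>w. c * \<phi> x w))
           \<and> (\<forall>x\<in>peak_alg n. \<forall>y\<in>peak_alg n.
                \<phi> (ga_mult n x y) = ga_mult (n - 2) (\<phi> x) (\<phi> y))
           \<and> (\<forall>x\<in>peak_alg n. \<phi> x = (\<lambda>w. 0) \<longleftrightarrow> x \<in> peak_ideal n)))"
proof (intro conjI impI)
  assume "2 \<le> n"
  then obtain m where n: "n = m + 2" by (metis add.commute le_Suc_ex)
  have "peak_red m (\<lambda>w. x w + y w) = (\<lambda>w. peak_red m x w + peak_red m y w)"
    "peak_red m (\<lambda>w. c * x w) = (\<lambda>w. c * peak_red m x w)" for x y c
    by (auto simp: peak_red_def right_diff_distrib)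
  then show "\<exists>\<phi> :: (nat list \<Rightarrow> rat) \<Rightarrow> (nat list \<Rightarrow> rat).
             \<phi> ` peak_alg n = peak_alg (n - 2)
           \<and> (\<forall>x\<in>peak_alg n. \<forall>y\<in>peak_alg n. \<phi> (\<lambda>w. x w + y w) = (\<lambda>w. \<phi> x w + \<phi> y w))
           \<and> (\<forall>x\<in>peak_alg n. \<forall>c::rat. \<phi> (\<lambda>w. c * x w) = (\<lambda>w. c * \<phi> x w))
           \<and> (\<forall>x\<in>peak_alg n. \<forall>y\<in>peak_alg n.
                \<phi> (ga_mult n x y) = ga_mult (n - 2) (\<phi> x) (\<phi> y))
           \<and> (\<forall>x\<in>peak_alg n. \<phi> x = (\<lambda>w. 0) \<longleftrightarrow> x \<in> peak_ideal n)"
    unfolding n add_diff_cancel_right'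
    by (intro exI[of _ "peak_red m"] conjI ballI allI)
      (simp_all add: peak_red_image peak_red_mult peak_red_kernel del: add_2_eq_Suc')
qed (use peak_ideal_subset peak_ideal_two_sided in auto)

end
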